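(* Let $\lambda=-\gamma$, where $\gamma=\frac{1+\sqrt5}2$. For $z\in[0,1)^2$ the minimal period length $\pi(z)$ is: \begin{itemize} \item $1$ if $z\in\{(0,0),(1/\gamma^2,1/\gamma^2),(2/\gamma^2,2/\gamma^2)\}$; \item $2$ if $z\in\left\{\left(\frac{5-\gamma}{\gamma^2+1},\frac{2/\gamma^2}{\gamma^2+1}\right),\left(\frac{2/\gamma^2}{\gamma^2+1},\frac{5-\gamma}{\gamma^2+1}\right)\right\}$; \item $5$ if $z=T^m(1/(2\gamma^4),1/(2\gamma^4))$ for some $m\in\{0,1,2,3,4\}$; \item $10$ for the other points of $D_A$, $D_B$, $T^m(D_\Gamma)$ ($0\le m\le4$), $T^m(D_\Delta)$ ($0\le m\le1$); \item $11$ if $z=T^m(1-1/\gamma^5,1-1/\gamma^5)$ for some $m\in\{0,1,\ldots,10\}$; \item $25$ if $z=T^m(1-1/(2\gamma^5),1-1/(2\gamma^5))$ for some $m\in\{0,1,\ldots,24\}$; \item $50$ for the other points of $T^m(D_E)$, $0\le m\le24$; \item $2(35\cdot4^n+28)/3$ if $S^nR(z)$ is the center of $D_\alpha$, for some $n\ge0$; \item $10(35\cdot4^n+28)/3$ for the other points with $S^nR(z)\in D_\alpha$, $n\ge0$; \item $4(35\cdot4^n-14)/3$ if $S^nR(z)$ is the center of $D_\beta$, for some $n\ge0$; \item $20(35\cdot4^n-14)/3$ for the other points with $S^nR(z)\in D_\beta$, $n\ge0$; \item $\infty$ if $S^nR(z)\in\mathcal D\setminus\mathcal P$ for all $n\ge0$.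 \end{itemize}
   Context: $T:[0,1)^2\to[0,1)^2$ is the bijection $T(x,y)=(y,\{-x-y/\gamma\})$ ($\{\cdot\}$ applied to a real number is the fractional part), i.e. $T(x,y)=(x,y)A+(0,\lceil x+y/\gamma\rceil)$ with $A=\begin{pmatrix}0&-1\\1&-1/\gamma\end{pmatrix}$ (row vectors). $\pi(z)$ is the least $p\ge1$ with $T^p(z)=z$, and $\infty$ if none exists. $\mathcal D=\{(x,y)\in[0,1)^2:x<y,\ \gamma x+y\ge4-\gamma\}$, $D_0=\{(x,y)\in\mathcal D:x>1-1/\gamma^5\}$, $D_1=\{(x,y)\in\mathcal D:x\le1-1/\gamma^5\}$; $\mathcal R=\{z\in[0,1)^2:T^m(z)\notin\mathcal D\text{ for all }m\ge0\}$. For $z\notin\mathcal R$, $R(z)=T^{r(z)}(z)$ with $r(z)=\min\{m\ge0:T^m(z)\in\mathcal D\}$. $\hat T:\mathcal D\to\mathcal D$ is the first return map of $T$ to $\mathcal D$, $\hat T(z)=R(T(z))$ (a bijection). $D_A=\{z\in[0,1)^2:T^{k+1}(z)=T^k(z)A+(0,1)\text{ for all }k\in\mathbb Z\}$, $D_B=\{z\in[0,1)^2:T^{k+1}(z)=T^k(z)A+(0,2)\text{ for all }k\in\mathbb Z\}$, $D_\Gamma=\{(x,y):0\le x,y\le1/\gamma^4\}\setminus\{(0,0),(1/\gamma^4,1/\gamma^4)\}$, $D_\Delta=\{z\in[0,1)^2:T^{2k+1}(z)=T^{2k}(z)A+(0,2),\ T^{2k}(z)=T^{2k-1}(z)A+(0,1)\text{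 for all }k\in\mathbb Z\}$, $D_E=\{(x,x):1-1/\gamma^5<x<1\}$. $D_\alpha=\{z\in\mathcal D:\hat T^k(z)\in D_0\text{ for all }k\in\mathbb Z\}$ and $D_\beta=\{z\in\mathcal D:\hat T^k(z)\in D_1\text{ for all }k\in\mathbb Z\}$; these are pentagons mapped onto themselves by $\hat T$, and the center of $D_\alpha$ (resp. $D_\beta$) is its centroid, equivalently the fixed point of $\hat T$ in it. $U(z)=z/\gamma^2+(1/\gamma,1/\gamma)$, and $\mathcal P=\{z\in\mathcal D:\hat T^m(z)\notin U(\mathcal D)\text{ for all }m\in\mathbb Z\}=D_\alpha\cup D_\beta$. For $z\in\mathcal D\setminus\mathcal P$ fix $\hat s(z)$ as either $\min\{m\ge0:\hat T^m(z)\in U(\mathcal D)\}$ or $\max\{m\le0:\hat T^m(z)\in U(\mathcal D)\}$ (one that exists), and let $S(z)=U^{-1}\hat T^{\hat s(z)}(z)$, $S:\mathcal D\setminus\mathcal P\to\mathcal D$. For $z\notin\mathcal R$: $S^0R(z)=R(z)$, and $S^nR(z)=S(S^{n-1}R(z))$ is defined as long as $S^{n-1}R(z)$ is defined and in $\mathcal D\setminus\mathcal P$. Conditions on $S^nR(z)$ include that $z\notin\mathcal R$ and that it is defined. *)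

theory Defs
  imports "HOL-Analysis.Analysis" "HOL-Library.Extended_Nat"
begin

definition \<gamma> :: real where
  "\<gamma> = (1 + sqrt 5) / 2"

definition unit_square :: "(real \<times> real) set" where
  "unit_square = {0..<1} \<times> {0..<1}"

definition Tmap :: "real \<times> real \<Rightarrow> real \<times> real" where
  "Tmap = (\<lambda>(x, y). (y, frac (- x - y / \<gamma>)))"

(* the row vector (x, y) times the matrix A with rows (0, -1) and (1, -1/\<gamma>) *)
definition mulA :: "real \<times> real \<Rightarrow> real \<times> real" where
  "mulA = (\<lambda>(x, y). (y, - x - y / \<gamma>))"

lemma Tmap_affine: "Tmap (x, y) = mulA (x, y) + (0, of_int \<lceil>x + y / \<gamma>\<rceil>)"
proof -
  have "- x - y / \<gamma> = - (x + y / \<gamma>)" by simp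
  then have "frac (- x - y / \<gamma>) = - (x + y / \<gamma>) + of_int \<lceil>x + y / \<gamma>\<rceil>"
    by (simp only: frac_def ceiling_def of_int_minus diff_conv_add_uminus minus_minus)
  then show ?thesis by (simp add: Tmap_def mulA_def)
qed

(* Integer iterates of a map f that restricts to a bijection of X; meaningful at points of X. *)
definition int_iter :: "'a set \<Rightarrow> ('a \<Rightarrow> 'a) \<Rightarrow> int \<Rightarrow> 'a \<Rightarrow> 'a" where
  "int_iter X f k = (if 0 \<le> k then f ^^ nat k else inv_into X f ^^ nat (- k))"

abbreviation Titer :: "int \<Rightarrow> real \<times> real \<Rightarrow> real \<times> real" where
  "Titer \<equiv> int_iter unit_square Tmap"

definition min_period :: "real \<times> real \<Rightarrow> enat" where
  "min_period z =
     (if \<exists>p\<ge>1. (Tmap ^^ p) z = z then enat (LEAST p. 1 \<le> p \<and> (Tmap ^^ p) z = z) else \<infinity>)"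

definition Dset :: "(real \<times> real) set" where
  "Dset = {(x, y). (x, y) \<in> unit_square \<and> x < y \<and> \<gamma> * x + y \<ge> 4 - \<gamma>}"

definition D0 :: "(real \<times> real) set" where
  "D0 = {(x, y). (x, y) \<in> Dset \<and> x > 1 - 1 / \<gamma> ^ 5}"

definition D1 :: "(real \<times> real) set" where
  "D1 = {(x, y). (x, y) \<in> Dset \<and> x \<le> 1 - 1 / \<gamma> ^ 5}"

definition Rset :: "(real \<times> real) set" where
  "Rset = {z \<in> unit_square. \<forall>m. (Tmap ^^ m) z \<notin> Dset}"

definition Rmap :: "real \<times> real \<Rightarrow> real \<times> real" where
  "Rmap z = (Tmap ^^ (LEAST m. (Tmap ^^ m) z \<in> Dset)) z"

definition That :: "real \<times> real \<Rightarrow> real \<times> real" where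
  "That z = Rmap (Tmap z)"

abbreviation That_iter :: "int \<Rightarrow> real \<times> real \<Rightarrow> real \<times> real" where
  "That_iter \<equiv> int_iter Dset That"

definition D_A :: "(real \<times> real) set" where
  "D_A = {z \<in> unit_square. \<forall>k. Titer (k + 1) z = mulA (Titer k z) + (0, 1)}"

definition D_B :: "(real \<times> real) set" where
  "D_B = {z \<in> unit_square. \<forall>k. Titer (k + 1) z = mulA (Titer k z) + (0, 2)}"

definition D_Gamma :: "(real \<times> real) set" where
  "D_Gamma = {(x, y). 0 \<le> x \<and> x \<le> 1 / \<gamma> ^ 4 \<and> 0 \<le> y \<and> y \<le> 1 / \<gamma> ^ 4}
             - {(0, 0), (1 / \<gamma> ^ 4, 1 / \<gamma> ^ 4)}"

definition D_Delta :: "(real \<times> real) set" where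
  "D_Delta = {z \<in> unit_square. \<forall>k.
      Titer (2 * k + 1) z = mulA (Titer (2 * k) z) + (0, 2) \<and>
      Titer (2 * k) z = mulA (Titer (2 * k - 1) z) + (0, 1)}"

definition D_E :: "(real \<times> real) set" where
  "D_E = {(x, x) | x. 1 - 1 / \<gamma> ^ 5 < x \<and> x < 1}"

definition D_alpha :: "(real \<times> real) set" where
  "D_alpha = {z \<in> Dset. \<forall>k. That_iter k z \<in> D0}"

definition D_beta :: "(real \<times> real) set" where
  "D_beta = {z \<in> Dset. \<forall>k. That_iter k z \<in> D1}"

definition centroid :: "(real \<times> real) set \<Rightarrow> real \<times> real" where
  "centroid X = (1 / measure lborel X) *\<^sub>R (LINT z:X|lborel. z)"

definition Umap :: "real \<times> real \<Rightarrow> real \<times> real" where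
  "Umap z = (1 / \<gamma>\<^sup>2) *\<^sub>R z + (1 / \<gamma>, 1 / \<gamma>)"

definition Pset :: "(real \<times> real) set" where
  "Pset = {z \<in> Dset. \<forall>m. That_iter m z \<notin> Umap ` Dset}"

(* For every z in Dset - Pset, the number s z is the minimal m \<ge> 0 or the maximal m \<le> 0 such that
   the m-th iterate of That takes z into U(D); either choice is allowed, separately for each z. *)
definition admissible_shat :: "(real \<times> real \<Rightarrow> int) \<Rightarrow> bool" where
  "admissible_shat s \<longleftrightarrow> (\<forall>z \<in> Dset - Pset.
      That_iter (s z) z \<in> Umap ` Dset \<and>
      (0 \<le> s z \<and> (\<forall>m. 0 \<le> m \<and> That_iter m z \<in> Umap ` Dset \<longrightarrow> s z \<le> m) \<or>
       s z \<le> 0 \<and> (\<forall>m. m \<le> 0 \<and> That_iter m z \<in> Umap ` Dset \<longrightarrow> m \<le> s z)))"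

definition Smap :: "(real \<times> real \<Rightarrow> int) \<Rightarrow> real \<times> real \<Rightarrow> real \<times> real" where
  "Smap s z = inv Umap (That_iter (s z) z)"

(* SR s n z is Some w if the n-th iterate of S at R(z) is defined and equal to w, None otherwise. *)
fun SR :: "(real \<times> real \<Rightarrow> int) \<Rightarrow> nat \<Rightarrow> real \<times> real \<Rightarrow> (real \<times> real) option" where
  "SR s 0 z = (if z \<in> Rset then None else Some (Rmap z))"
| "SR s (Suc n) z =
     (case SR s n z of
        None \<Rightarrow> None
      | Some w \<Rightarrow> if w \<in> Dset - Pset then Some (Smap s w) else None)"

definition pts1 :: "(real \<times> real) set" where
  "pts1 = {(0, 0), (1 / \<gamma>\<^sup>2, 1 / \<gamma>\<^sup>2), (2 / \<gamma>\<^sup>2, 2 / \<gamma>\<^sup>2)}"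

definition pts2 :: "(real \<times> real) set" where
  "pts2 = {((5 - \<gamma>) / (\<gamma>\<^sup>2 + 1), (2 / \<gamma>\<^sup>2) / (\<gamma>\<^sup>2 + 1)),
           ((2 / \<gamma>\<^sup>2) / (\<gamma>\<^sup>2 + 1), (5 - \<gamma>) / (\<gamma>\<^sup>2 + 1))}"

definition pts5 :: "(real \<times> real) set" where
  "pts5 = {(Tmap ^^ m) (1 / (2 * \<gamma> ^ 4), 1 / (2 * \<gamma> ^ 4)) | m. m \<le> 4}"

definition pts10 :: "(real \<times> real) set" where
  "pts10 = (D_A \<union> D_B \<union> (\<Union>m\<le>4. (Tmap ^^ m) ` D_Gamma) \<union> (\<Union>m\<le>1. (Tmap ^^ m) ` D_Delta))
           - (pts1 \<union> pts2 \<union> pts5)"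

definition pts11 :: "(real \<times> real) set" where
  "pts11 = {(Tmap ^^ m) (1 - 1 / \<gamma> ^ 5, 1 - 1 / \<gamma> ^ 5) | m. m \<le> 10}"

definition pts25 :: "(real \<times> real) set" where
  "pts25 = {(Tmap ^^ m) (1 - 1 / (2 * \<gamma> ^ 5), 1 - 1 / (2 * \<gamma> ^ 5)) | m. m \<le> 24}"

definition pts50 :: "(real \<times> real) set" where
  "pts50 = (\<Union>m\<le>24. (Tmap ^^ m) ` D_E) - pts25"

end

theory Submission
  imports Defs
begin

text \<open>
  On each set where $\lceil x + y/\gamma\rceil$ has a fixed value, $T$ is an affine map whose linear
  part $A$ has order $10$ and satisfies $A^5 = -1$. So $T$ is, up to a linear change of coordinates,
  a piecewise rotation, and the proof computes its first return maps. Write $\hat T$ for the first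
  return map to the triangle $\mathcal D$. Everything rests on three finite geometric facts about
  polygons with coordinates in the ring generated by $\tau = 1/\gamma$.

  First, all points of $D_0$ return to $\mathcal D$ after $42$ steps with the same itinerary, and
  all points of $D_1$ after $28$ steps (\<open>return_D0\<close>, \<open>return_D1\<close>). So $\hat T$ has two affine
  branches, and both are conjugate to rotations of order five.

  Second, $\hat T$ is self-similar: the first return map of $\hat T$ to $U(\mathcal D)$ is
  $U \hat T U^{-1}$, the orbits of $U(D_0)$ and $U(D_1)$ visit the branches $0,1,0$ and $0,1,1,1,0$
  before they return, and these eight triangles together with the pentagons $D_\alpha$ and
  $D_\beta$ fill $\mathcal D$ (\<open>That_Umap\<close>, \<open>D_cover\<close>).

  Third, the levels of the tower of $T$ over $\mathcal D$ and the explicitly known invariant pieces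
  (the decagons $D_A$ and $D_B$, the images of $D_\Gamma$, $D_\Delta$ and $D_E$, the orbit of length
  $11$ and the origin) fill the unit square (\<open>square_cover\<close>).

  The periods follow by counting. The period of a point of $\mathcal D$ is the sum over one period
  of $\hat T$ of the weights $42$ and $28$ of the branches. By self-similarity, replacing $z$ by
  $S(z)$ does not change this sum if the weights $(a, b)$ are replaced by $(2a + b, 2a + 3b)$
  (\<open>weighted_period_Umap\<close>). After $n$ steps they have become $2(35 \cdot 4^n + 28)/3$ and
  $4(35 \cdot 4^n - 14)/3$. If $S^n R(z)$ lies in one of the pentagons, it stays in one branch and
  has $\hat T$-period $1$ or $5$, depending on whether it is the center, which gives the four
  formulas. If $S$ can be applied forever, the period exceeds all weights and is infinite. A point
  where $S$ stops lies in a pentagon by the second fact, and a point that never reaches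
  $\mathcal D$ lies in an invariant piece by the third one, where the period is a divisor of $10$,
  $11$ or $50$ that is found by solving linear equations.

  The geometric facts are inclusions, disjointness and covering statements for polygons. They are
  decided by exact integer arithmetic: polygons are lists of half-planes with coefficients
  $a + b\tau$, inclusions are certified by nonnegative combinations of two edges (\<open>farkas\<close>), and
  coverings by binary space partitions (\<open>covers\<close>).
\<close>

section \<open>Exact arithmetic in the ring of golden integers\<close>

text \<open>
  All polygons below have coordinates in the ring generated by $1/\gamma$. Since
  $\tau = 1/\gamma$ satisfies $\tau^2 = 1 - \tau$, every element of it is $a + b\tau$ with
  integers $a$, $b$.
\<close>

definition \<tau> :: real where "\<tau> = 1 / \<gamma>"

lemma tau_eq: "\<tau> = (sqrt 5 - 1) / 2"
proof -
  have "(sqrt 5 - 1) * (1 + sqrt 5) = 4" by (simp add: algebra_simps)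
  moreover have "1 + sqrt 5 \<noteq> (0::real)" using real_sqrt_ge_zero[of 5] by linarith
  ultimately show ?thesis by (simp add: \<tau>_def \<gamma>_def field_simps)
qed

lemma gamma_tau: "\<gamma> = 1 + \<tau>"
  by (simp add: tau_eq \<gamma>_def field_simps)

lemma tau_sq: "\<tau> * \<tau> = 1 - \<tau>"
  by (simp add: tau_eq field_simps)

lemma mult_tau_sq: "\<tau> * (\<tau> * x) = x - \<tau> * x"
  using tau_sq by (metis left_diff_distrib mult.assoc mult_1)

lemma tau_gamma: "1 / \<gamma> = \<tau>" "\<gamma> * \<tau> = 1" "1 / \<gamma>\<^sup>2 = 1 - \<tau>" "1 / \<gamma> ^ 4 = 2 - 3 * \<tau>" "1 / \<gamma> ^ 5 = 5 * \<tau> - 3"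
proof -
  show a: "1 / \<gamma> = \<tau>" by (simp add: \<tau>_def)
  show "\<gamma> * \<tau> = 1" using tau_sq by (simp add: gamma_tau algebra_simps)
  have "1 / \<gamma>\<^sup>2 = \<tau> * \<tau>" by (simp add: power2_eq_square \<tau>_def)
  then show 2: "1 / \<gamma>\<^sup>2 = 1 - \<tau>" by (simp add: tau_sq)
  have "1 / \<gamma> ^ 4 = (1 / \<gamma>\<^sup>2) * (1 / \<gamma>\<^sup>2)" by (simp add: power2_eq_square power4_eq_xxxx)
  also have "\<dots> = 2 - 3 * \<tau>" unfolding 2 using tau_sq by (simp add: algebra_simps)
  finally show 4: "1 / \<gamma> ^ 4 = 2 - 3 * \<tau>" .
  have "1 / \<gamma> ^ 5 = (1 / \<gamma> ^ 4) * (1 / \<gamma>)" by (simp add: eval_nat_numeral)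
  also have "\<dots> = 5 * \<tau> - 3" unfolding 4 a using tau_sq by (simp add: algebra_simps)
  finally show "1 / \<gamma> ^ 5 = 5 * \<tau> - 3" .
qed

lemma tau_bounds: "0.618 < \<tau>" "\<tau> < 0.6181"
proof -
  have "2.236 < sqrt 5" by (rule real_less_rsqrt) (simp add: power2_eq_square)
  moreover have "sqrt 5 < 2.2362" by (rule real_less_lsqrt) (simp_all add: power2_eq_square)
  ultimately show "0.618 < \<tau>" "\<tau> < 0.6181" by (simp_all add: tau_eq)
qed

text \<open>
  The pair $(a, b)$ stands for $a + b\tau$.
\<close>

type_synonym golden = "int \<times> int"

fun gval :: "golden \<Rightarrow> real" where
  "gval (a, b) = of_int a + of_int b * \<tau>"

fun gadd :: "golden \<Rightarrow> golden \<Rightarrow> golden" where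
  "gadd (a, b) (c, d) = (a + c, b + d)"

fun gsub :: "golden \<Rightarrow> golden \<Rightarrow> golden" where
  "gsub (a, b) (c, d) = (a - c, b - d)"

fun gmul :: "golden \<Rightarrow> golden \<Rightarrow> golden" where
  "gmul (a, b) (c, d) = (a * c + b * d, a * d + b * c - b * d)"

fun gmul_tau :: "golden \<Rightarrow> golden" where
  "gmul_tau (a, b) = (b, a - b)"

text \<open>
  The sign is decided in integer arithmetic: $2(a + b\tau) = p + b\sqrt 5$ with
  $p = 2a - b$, so when $p$ and $b$ have opposite signs the squares $p^2$ and $5 b^2$ have to be
  compared.
\<close>

fun gpos :: "golden \<Rightarrow> bool" where
  "gpos (a, b) \<longleftrightarrow>
     0 \<le> b \<and> (0 < 2 * a - b \<or> (2 * a - b)\<^sup>2 < 5 * b\<^sup>2) \<or>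
     b < 0 \<and> 0 < 2 * a - b \<and> 5 * b\<^sup>2 < (2 * a - b)\<^sup>2"

definition gnonneg :: "golden \<Rightarrow> bool" where
  "gnonneg u \<longleftrightarrow> gpos u \<or> u = (0, 0)"

lemma gval_gadd [simp]: "gval (gadd u v) = gval u + gval v"
  by (cases u; cases v) (simp add: algebra_simps)

lemma gval_gsub [simp]: "gval (gsub u v) = gval u - gval v"
  by (cases u; cases v) (simp add: algebra_simps)

lemma gval_gmul [simp]: "gval (gmul u v) = gval u * gval v"
proof (cases u; cases v)
  fix a b c d assume "u = (a, b)" "v = (c, d)"
  moreover have "(of_int a + of_int b * \<tau>) * (of_int c + of_int d * \<tau>)
    = of_int a * of_int c + (of_int a * of_int d + of_int b * of_int c) * \<tau> + of_int b * of_int d * (\<tau> * \<tau>)"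
    by (simp add: algebra_simps)
  ultimately show ?thesis by (simp add: tau_sq algebra_simps)
qed

lemma gval_gmul_tau [simp]: "gval (gmul_tau u) = \<tau> * gval u"
proof (cases u)
  case (Pair a b)
  have "\<tau> * gval u = of_int a * \<tau> + of_int b * (\<tau> * \<tau>)" by (simp add: Pair algebra_simps)
  then show ?thesis by (simp add: Pair tau_sq algebra_simps)
qed

lemma gpos_sound: assumes "gpos u" shows "0 < gval u"
proof (cases u)
  case (Pair a b)
  define p q where "p = real_of_int (2 * a - b)" and "q = real_of_int b * sqrt 5"
  have v: "2 * gval u = p + q" by (simp add: Pair p_def q_def tau_eq field_simps)
  have q2: "q\<^sup>2 = of_int (5 * b\<^sup>2)" by (simp add: q_def power_mult_distrib)
  have p2: "p\<^sup>2 = of_int ((2 * a - b)\<^sup>2)" by (simp add: p_def)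
  consider "0 \<le> q" "0 < p" | "0 \<le> q" "p\<^sup>2 < q\<^sup>2" | "0 < p" "q\<^sup>2 < p\<^sup>2"
    using assms unfolding Pair gpos.simps p2 q2 of_int_less_iff
    by (auto simp: p_def q_def simp del: of_int_diff of_int_mult)
  then have "0 < p + q"
  proof cases
    case 2
    then have "\<bar>p\<bar> < \<bar>q\<bar>" using abs_le_square_iff[of q p] by linarith
    with 2 show ?thesis by linarith
  next
    case 3
    then have "\<bar>q\<bar> < \<bar>p\<bar>" using abs_le_square_iff[of p q] by linarith
    with 3 show ?thesis by linarith
  qed simp
  with v show ?thesis by simp
qed

lemma gnonneg_sound: "gnonneg u \<Longrightarrow> 0 \<le> gval u"
  using gpos_sound[of u] by (auto simp: gnonneg_def simp del: gpos.simps)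

section \<open>Convex polygons as lists of half-planes\<close>

text \<open>
  The tuple $(m, n, c, s)$ is the half-plane $m x + n y + c \ge 0$ with golden coefficients;
  the flag $s$ says that its boundary line is excluded. Boundaries matter here: the pieces of the
  tilings below have to fit together exactly, including edges and vertices.
\<close>

type_synonym halfplane = "golden \<times> golden \<times> golden \<times> bool"

fun lin :: "halfplane \<Rightarrow> real \<times> real \<Rightarrow> real" where
  "lin (m, n, c, s) (x, y) = gval m * x + gval n * y + gval c"

fun strict :: "halfplane \<Rightarrow> bool" where
  "strict (m, n, c, s) = s"

definition holds :: "halfplane \<Rightarrow> real \<times> real \<Rightarrow> bool" where
  "holds k z \<longleftrightarrow> 0 \<le> lin k z \<and> (strict k \<longrightarrow> lin k z \<noteq> 0)"

definition region :: "halfplane list \<Rightarrow> (real \<times> real) set" where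
  "region P = {z. \<forall>k\<in>set P. holds k z}"

fun opposite :: "halfplane \<Rightarrow> halfplane" where
  "opposite (m, n, c, s) = (gsub (0, 0) m, gsub (0, 0) n, gsub (0, 0) c, \<not> s)"

lemma holds_opposite: "holds (opposite k) z \<longleftrightarrow> \<not> holds k z"
  by (cases k; cases z) (auto simp: holds_def algebra_simps)

fun cross :: "halfplane \<Rightarrow> halfplane \<Rightarrow> golden" where
  "cross (m, n, c, s) (m', n', c', s') = gsub (gmul m n') (gmul n m')"

fun offset :: "halfplane \<Rightarrow> golden" where
  "offset (m, n, c, s) = c"

fun slack :: "golden \<Rightarrow> golden \<Rightarrow> golden \<Rightarrow> halfplane \<Rightarrow> halfplane \<Rightarrow> halfplane \<Rightarrow> golden" where
  "slack d a b k p q = gsub (gsub (gmul d (offset k)) (gmul a (offset p))) (gmul b (offset q))"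

text \<open>
  By Cramer's rule the normals satisfy
  $\mathrm{cross}(p,q)\, k = \mathrm{cross}(k,q)\, p + \mathrm{cross}(p,k)\, q$. If these three
  coefficients have the right signs and the remaining constant is nonnegative, the half-plane $k$
  contains the intersection of $p$ and $q$. Strictness of $k$ has to come from the constant or
  from a strict half-plane that enters with a positive coefficient.
\<close>

definition farkas :: "halfplane \<Rightarrow> halfplane \<Rightarrow> halfplane \<Rightarrow> bool" where
  "farkas k p q \<longleftrightarrow>
     gpos (cross p q) \<and> gnonneg (cross k q) \<and> gnonneg (cross p k) \<and>
     (if strict k \<and> \<not> (strict p \<and> gpos (cross k q)) \<and> \<not> (strict q \<and> gpos (cross p k))
      then gpos (slack (cross p q) (cross k q) (cross p k) k p q)
      else gnonneg (slack (cross p q) (cross k q) (cross p k) k p q))"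

lemma farkas_identity:
  "gval (cross p q) * lin k z = gval (cross k q) * lin p z + gval (cross p k) * lin q z
     + (gval (cross p q) * gval (offset k) - gval (cross k q) * gval (offset p) - gval (cross p k) * gval (offset q))"
  by (cases p; cases q; cases k; cases z) (simp add: algebra_simps)

lemma farkas_sound:
  assumes f: "farkas k p q" and p: "holds p z" and q: "holds q z"
  shows "holds k z"
proof -
  let ?d = "gval (cross p q)" and ?a = "gval (cross k q)" and ?b = "gval (cross p k)"
  let ?e = "gval (slack (cross p q) (cross k q) (cross p k) k p q)"
  have d: "0 < ?d" and a: "0 \<le> ?a" and b: "0 \<le> ?b"
    using f gpos_sound gnonneg_sound by (auto simp: farkas_def)
  have lp: "0 \<le> lin p z" "0 \<le> lin q z" using p q by (auto simp: holds_def)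
  have eq: "?d * lin k z = ?a * lin p z + ?b * lin q z + ?e"
    using farkas_identity[of p q k z] by simp
  have t: "0 \<le> ?a * lin p z" "0 \<le> ?b * lin q z" using a b lp by auto
  have "gnonneg (slack (cross p q) (cross k q) (cross p k) k p q)"
    using f unfolding farkas_def gnonneg_def by (auto split: if_splits)
  then have e: "0 \<le> ?e" by (rule gnonneg_sound)
  have "0 \<le> ?d * lin k z" using eq t e by linarith
  then have 1: "0 \<le> lin k z" using d by (simp add: zero_le_mult_iff)
  have 2: "0 < lin k z" if s: "strict k"
  proof -
    consider "strict p" "gpos (cross k q)" | "strict q" "gpos (cross p k)"
      | "gpos (slack (cross p q) (cross k q) (cross p k) k p q)"
      using f s unfolding farkas_def by (auto split: if_splits)
    then have "0 < ?a * lin p z + ?b * lin q z + ?e"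
    proof cases
      case 1
      then have "0 < ?a * lin p z" using gpos_sound p by (simp add: holds_def)
      with t e show ?thesis by linarith
    next
      case 2
      then have "0 < ?b * lin q z" using gpos_sound q by (simp add: holds_def)
      with t e show ?thesis by linarith
    next
      case 3
      with t gpos_sound show ?thesis by fastforce
    qed
    then show ?thesis using eq d by (metis zero_less_mult_pos)
  qed
  show ?thesis using 1 2 by (auto simp: holds_def)
qed

text \<open>
  In the plane, a linear inequality that is valid on a nonempty polygon with a vertex is a
  nonnegative combination of two edges through a vertex and a constant, so it is found by trying
  all pairs of edges.
\<close>

definition implied :: "halfplane list \<Rightarrow> halfplane \<Rightarrow> bool" where
  "implied P k = list_ex (\<lambda>p. list_ex (farkas k p) P) P"

lemma implied_sound: "implied P k \<Longrightarrow> z \<in> region P \<Longrightarrow> holds k z"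
  unfolding implied_def list_ex_iff region_def using farkas_sound by blast

definition inside :: "halfplane list \<Rightarrow> halfplane list \<Rightarrow> bool" where
  "inside P Q = list_all (implied P) Q"

lemma inside_sound: "inside P Q \<Longrightarrow> region P \<subseteq> region Q"
  using implied_sound unfolding inside_def list_all_iff by (auto simp: region_def)

text \<open>
  Disjoint closed convex polygons with nonempty interior are separated by a line through an edge of
  one of them, so only edges are tried.
\<close>

definition apart :: "halfplane list \<Rightarrow> halfplane list \<Rightarrow> bool" where
  "apart P Q = (list_ex (\<lambda>k. implied P (opposite k)) Q \<or> list_ex (\<lambda>k. implied Q (opposite k)) P)"

lemma apart_sound: assumes "apart P Q" shows "region P \<inter> region Q = {}"
proof -
  have "False" if z: "z \<in> region P" "z \<in> region Q" for z
    using assms unfolding apart_def list_ex_iff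
  proof (elim disjE bexE)
    fix k assume "k \<in> set Q" "implied P (opposite k)"
    then show False using implied_sound z holds_opposite unfolding region_def by blast
  next
    fix k assume "k \<in> set P" "implied Q (opposite k)"
    then show False using implied_sound z holds_opposite unfolding region_def by blast
  qed
  then show ?thesis by blast
qed

text \<open>
  A binary space partition certifies that a polygon is covered by a list of polygons: it is
  cut along lines until every part lies in a single one of them.
\<close>

datatype bsp = Piece nat | Cut halfplane bsp bsp

fun covers :: "halfplane list list \<Rightarrow> bsp \<Rightarrow> halfplane list \<Rightarrow> bool" where
  "covers Qs (Piece i) P = (i < length Qs \<and> inside P (Qs ! i))"
| "covers Qs (Cut k l r) P = (covers Qs l (k # P) \<and> covers Qs r (opposite k # P))"

lemma covers_sound: "covers Qs t P \<Longrightarrow> z \<in> region P \<Longrightarrow> \<exists>Q\<in>set Qs. z \<in> region Q"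
proof (induction t arbitrary: P)
  case (Piece i) then show ?case using inside_sound[of P "Qs ! i"] nth_mem[of i Qs] by auto
next
  case (Cut k l r)
  show ?case
  proof (cases "holds k z")
    case True then show ?thesis using Cut by (auto simp: region_def split: if_splits)
  next
    case False then show ?thesis using Cut holds_opposite[of k z] by (auto simp: region_def split: if_splits)
  qed
qed

section \<open>Itineraries\<close>

text \<open>
  On the set where $\lceil x + y/\gamma\rceil = b$ the map $T$ is this affine map. Its linear
  part $A$ is conjugate to the rotation by $3\pi/5$, so $A^5 = -1$ and $A^{10} = 1$.
\<close>

fun step :: "int \<Rightarrow> real \<times> real \<Rightarrow> real \<times> real" where
  "step b (x, y) = (y, of_int b - x - \<tau> * y)"

definition run :: "int list \<Rightarrow> real \<times> real \<Rightarrow> real \<times> real" where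
  "run w = fold step w"

lemma run_simps [simp]: "run [] z = z" "run (b # w) z = run w (step b z)" 
  by (simp_all add: run_def)

lemma run_append: "run (v @ w) z = run w (run v z)"
  by (simp add: run_def)

lemma step_mulA: "step b z = mulA z + (0, of_int b)"
  by (cases z) (simp add: mulA_def tau_gamma divide_inverse[of _ \<gamma>] \<tau>_def)

text \<open>
  No ceiling has to be evaluated: if the affine map for some integer $b$ yields a coordinate in
  $[0,1)$, then that coordinate is the fractional part.
\<close>

lemma Tmap_step:
  assumes "0 \<le> snd (step b z)" "snd (step b z) < 1"
  shows "Tmap z = step b z"
proof (cases z)
  case (Pair x y)
  have "frac (- x - y / \<gamma>) = of_int b - x - \<tau> * y"
    by (subst frac_unique_iff) (use assms in \<open>simp add: Pair \<tau>_def\<close>)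
  then show ?thesis by (simp add: Pair Tmap_def)
qed

fun img :: "int \<Rightarrow> halfplane \<Rightarrow> halfplane" where
  "img b (m, n, c, s) = (gsub n (gmul_tau m), gsub (0, 0) m, gadd c (gmul (b, 0) m), s)"

lemma lin_img: "lin (img b k) (step b z) = lin k z"
  by (cases k; cases z) (simp add: algebra_simps)

lemma strict_img [simp]: "strict (img b k) = strict k"
  by (cases k) simp

lemma holds_img: "holds (img b k) (step b z) = holds k z"
  by (simp add: holds_def lin_img)

definition imgs :: "int list \<Rightarrow> halfplane list \<Rightarrow> halfplane list" where
  "imgs w P = fold (\<lambda>b. map (img b)) w P"

lemma region_img: "step b z \<in> region (map (img b) P) \<longleftrightarrow> z \<in> region P"
  by (simp add: region_def holds_img)

lemma region_imgs: "run w z \<in> region (imgs w P) \<longleftrightarrow> z \<in> region P"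
  unfolding run_def imgs_def by (induction w arbitrary: z P) (simp_all add: region_img)

lemma surj_step: "\<exists>u. z = step b u"
proof (cases z)
  case (Pair x y)
  then have "z = step b (of_int b - \<tau> * x - y, x)" by simp
  then show ?thesis by blast
qed

lemma surj_run: "\<exists>u. z = run w u"
proof (induction w arbitrary: z)
  case (Cons b w)
  then obtain v where "z = run w v" by blast
  moreover obtain u where "v = step b u" using surj_step by blast
  ultimately show ?case by (metis run_simps(2))
qed simp

lemma region_imgsE:
  assumes "z \<in> region (imgs w P)" obtains u where "u \<in> region P" "z = run w u"
  using assms surj_run[of z w] region_imgs by metis

text \<open>
  The condition that makes the last affine step an application of $T$.
\<close>

definition valid :: "halfplane list \<Rightarrow> bool" where
  "valid P = (implied P ((0,0), (1,0), (0,0), False) \<and> implied P ((0,0), (-1,0), (1,0), True))"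

text \<open>
  All points of the polygon have the itinerary $w$.
\<close>

fun follows :: "halfplane list \<Rightarrow> int list \<Rightarrow> bool" where
  "follows P [] = True"
| "follows P (b # w) = (valid (map (img b) P) \<and> follows (map (img b) P) w)"

lemma validD: assumes "valid P" "z \<in> region P" shows "0 \<le> snd z" "snd z < 1"
  using assms implied_sound[OF _ assms(2)] 
  by (cases z; force simp: valid_def holds_def split: if_splits)+

lemma valid_Tmap:
  assumes "valid (map (img b) P)" "z \<in> region P" shows "Tmap z = step b z"
  using assms validD[OF assms(1)] region_img Tmap_step by metis

lemma follows_sound:
  assumes "follows P w" "z \<in> region P" "j \<le> length w"
  shows "(Tmap ^^ j) z = run (take j w) z"
  using assms
proof (induction P w arbitrary: z j rule: follows.induct)
  case (2 P b w)
  have v: "valid (map (img b) P)" "follows (map (img b) P) w"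
    using 2(2) by simp_all
  have t: "Tmap z = step b z" using valid_Tmap[OF v(1) 2(3)] .
  show ?case
  proof (cases j)
    case (Suc i)
    have "(Tmap ^^ j) z = (Tmap ^^ i) (step b z)" by (simp add: Suc funpow_swap1 t)
    also have "\<dots> = run (take i w) (step b z)"
      using 2(1)[OF v(2)] 2(3,4) Suc by (simp add: region_img)
    finally show ?thesis by (simp add: Suc)
  qed simp
qed simp

text \<open>
  In addition, the polygon avoids $S$ after every proper nonempty prefix of $w$ and lies in $S$
  at the end, so that $w$ is the itinerary of the first return to $S$.
\<close>

fun returns :: "halfplane list \<Rightarrow> int list \<Rightarrow> halfplane list \<Rightarrow> bool" where
  "returns P [] S = inside P S"
| "returns P (b # w) S = (valid (map (img b) P) \<and>
     (w = [] \<or> apart (map (img b) P) S) \<and> returns (map (img b) P) w S)"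

lemma returns_follows: "returns P w S \<Longrightarrow> follows P w"
  by (induction P w S rule: returns.induct) auto

lemma returns_end: "returns P w S \<Longrightarrow> z \<in> region P \<Longrightarrow> run w z \<in> region S"
proof (induction P w S arbitrary: z rule: returns.induct)
  case (1 P S) then show ?case using inside_sound by auto
next
  case (2 P b w S)
  then show ?case by (simp add: region_img)
qed

lemma returns_avoid:
  "returns P w S \<Longrightarrow> z \<in> region P \<Longrightarrow> 0 < j \<Longrightarrow> j < length w \<Longrightarrow> run (take j w) z \<notin> region S"
proof (induction P w S arbitrary: z j rule: returns.induct)
  case (2 P b w S)
  let ?Q = "map (img b) P"
  have q: "step b z \<in> region ?Q" using 2(3) by (simp add: region_img)
  have w: "w \<noteq> []" using 2(4,5) by auto
  then have r: "returns ?Q w S" "apart ?Q S" using 2(2) by simp_all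
  show ?case
  proof (cases "j = 1")
    case True
    then show ?thesis using apart_sound[OF r(2)] q by auto
  next
    case False
    then obtain i where i: "j = Suc i" "0 < i" using 2(4) by (cases j) auto
    then show ?thesis using 2(1)[OF r(1) q, of i] 2(5) by simp
  qed
qed simp

lemma returns_sound:
  assumes "returns P w S" "z \<in> region P"
  shows "(Tmap ^^ length w) z = run w z" "run w z \<in> region S"
    "\<And>j. 0 < j \<Longrightarrow> j < length w \<Longrightarrow> (Tmap ^^ j) z \<notin> region S"
  using follows_sound[OF returns_follows[OF assms(1)] assms(2)] returns_end[OF assms]
    returns_avoid[OF assms] by auto

section \<open>Affine maps in golden coordinates\<close>

text \<open>
  The two components are the linear forms of the two coordinates of the image. Computing with
  them turns identities between compositions of many affine steps into integer arithmetic.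
\<close>

type_synonym affine = "(golden \<times> golden \<times> golden) \<times> (golden \<times> golden \<times> golden)"

fun affine_form :: "golden \<times> golden \<times> golden \<Rightarrow> real \<times> real \<Rightarrow> real" where
  "affine_form (m, n, c) (x, y) = gval m * x + gval n * y + gval c"

definition affine_map :: "affine \<Rightarrow> real \<times> real \<Rightarrow> real \<times> real" where
  "affine_map f z = (affine_form (fst f) z, affine_form (snd f) z)"

definition ident :: affine where
  "ident = (((1,0), (0,0), (0,0)), ((0,0), (1,0), (0,0)))"

fun astep :: "int \<Rightarrow> affine \<Rightarrow> affine" where
  "astep b ((m, n, c), (m', n', c')) = ((m', n', c'),
     (gsub (gsub (0,0) m) (gmul_tau m'), gsub (gsub (0,0) n) (gmul_tau n'), gsub (gsub (b,0) c) (gmul_tau c')))"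

definition arun :: "int list \<Rightarrow> affine \<Rightarrow> affine" where
  "arun w f = fold astep w f"

lemma affine_map_ident [simp]: "affine_map ident z = z"
  by (cases z) (simp add: affine_map_def ident_def)

lemma affine_map_astep: "affine_map (astep b f) z = step b (affine_map f z)"
proof -
  obtain m n c m' n' c' where f: "f = ((m, n, c), (m', n', c'))" by (metis surj_pair)
  show ?thesis by (cases z) (simp add: f affine_map_def algebra_simps)
qed

lemma affine_map_arun: "affine_map (arun w f) z = run w (affine_map f z)"
  unfolding arun_def by (induction w arbitrary: f) (simp_all add: affine_map_astep)

lemma run_affine: "run w z = affine_map (arun w ident) z"
  by (simp add: affine_map_arun)

lemma run_reflection:
  assumes "arun w ident = (((-1,0), (0,0), c), ((0,0), (-1,0), d))"
  shows "run w (x, y) = (gval c - x, gval d - y)"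
  by (simp add: run_affine assms affine_map_def)

fun aadd :: "affine \<Rightarrow> affine \<Rightarrow> affine" where
  "aadd ((m, n, c), (m', n', c')) ((p, q, d), (p', q', d')) =
     ((gadd m p, gadd n q, gadd c d), (gadd m' p', gadd n' q', gadd c' d'))"

lemma affine_map_aadd: "affine_map (aadd f g) z = affine_map f z + affine_map g z"
proof -
  obtain m n c m' n' c' where f: "f = ((m, n, c), (m', n', c'))" by (metis surj_pair)
  obtain p q d p' q' d' where g: "g = ((p, q, d), (p', q', d'))" by (metis surj_pair)
  show ?thesis by (cases z) (simp add: f g affine_map_def algebra_simps)
qed

section \<open>Integer iterates of a bijection\<close>

lemma funpow_mem: assumes "f ` X \<subseteq> X" "x \<in> X" shows "(f ^^ n) x \<in> X"
  using assms by (induction n) auto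

lemma int_iter_of_nat [simp]: "int_iter X f (int n) x = (f ^^ n) x"
  by (simp add: int_iter_def)

lemma int_iter_mem:
  assumes "bij_betw f X X" "x \<in> X" shows "int_iter X f k x \<in> X"
proof -
  have "f ` X \<subseteq> X" "inv_into X f ` X \<subseteq> X"
    using assms(1) bij_betw_inv_into[OF assms(1)] by (auto simp: bij_betw_def)
  then show ?thesis using assms(2) unfolding int_iter_def by (auto intro: funpow_mem)
qed

lemma int_iter_succ:
  assumes "bij_betw f X X" "x \<in> X" shows "int_iter X f (k + 1) x = f (int_iter X f k x)"
proof (cases "0 \<le> k")
  case True
  then have "nat (k + 1) = Suc (nat k)" by simp
  then show ?thesis using True by (simp add: int_iter_def)
next
  case False
  define n where "n = nat (- k - 1)"
  have n: "nat (- k) = Suc n" "nat (- (k + 1)) = n" using False by (auto simp: n_def)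
  have i: "int_iter X f j x = (inv_into X f ^^ nat (- j)) x" if "j \<le> 0" for j
    using that by (cases "j = 0") (auto simp: int_iter_def)
  have "inv_into X f ` X \<subseteq> X"
    using bij_betw_inv_into[OF assms(1)] by (auto simp: bij_betw_def)
  then have "(inv_into X f ^^ n) x \<in> X" using assms(2) by (rule funpow_mem)
  then have "f (inv_into X f ((inv_into X f ^^ n) x)) = (inv_into X f ^^ n) x"
    using assms(1) by (intro f_inv_into_f) (simp add: bij_betw_def)
  then show ?thesis using False i[of k] i[of "k + 1"] n by simp
qed

text \<open>
  A two-sided orbit is determined by its value at $0$. All identities for integer iterates
  are instances of this.
\<close>

lemma int_iter_unique:
  assumes bij: "bij_betw f X X" and h: "h 0 = x" "\<And>k. h k \<in> X" "\<And>k. h (k + 1) = f (h k)"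
  shows "int_iter X f k x = h k"
proof -
  have x: "x \<in> X" using h(1) h(2)[of 0] by simp
  show ?thesis
  proof (induction k rule: int_induct[where k = 0])
    case base then show ?case using h(1) by (simp add: int_iter_def)
  next
    case (step1 i) then show ?case using int_iter_succ[OF bij x] h(3) by simp
  next
    case (step2 i)
    have "f (int_iter X f (i - 1) x) = f (h (i - 1))"
      using int_iter_succ[OF bij x, of "i - 1"] h(3)[of "i - 1"] step2 by simp
    then show ?case
      using bij int_iter_mem[OF bij x] h(2) unfolding bij_betw_def inj_on_def by metis
  qed
qed

lemma int_iter_uminus:
  assumes "bij_betw f X X" "x \<in> X" shows "int_iter X f (- k) (int_iter X f k x) = x"
proof -
  have "int_iter X f l (int_iter X f k x) = int_iter X f (k + l) x" for l
  proof (rule int_iter_unique[OF assms(1), where h = "\<lambda>l. int_iter X f (k + l) x"])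
    show "int_iter X f (k + (j + 1)) x = f (int_iter X f (k + j) x)" for j
      using int_iter_succ[OF assms, of "k + j"] by (simp add: add.assoc)
  qed (simp_all add: int_iter_mem[OF assms])
  from this[of "- k"] show ?thesis by (simp add: int_iter_def)
qed

lemma int_iter_periodic:
  assumes bij: "bij_betw f X X" and x: "x \<in> X" and p: "0 < p" "(f ^^ p) x = x"
  shows "int_iter X f k x = (f ^^ nat (k mod int p)) x"
proof (rule int_iter_unique[OF bij])
  fix k
  have "f ` X \<subseteq> X" using bij by (auto simp: bij_betw_def)
  then show "(f ^^ nat (k mod int p)) x \<in> X" using x by (rule funpow_mem)
  show "(f ^^ nat ((k + 1) mod int p)) x = f ((f ^^ nat (k mod int p)) x)"
  proof (cases "k mod int p + 1 = int p")
    case True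
    then have "(k + 1) mod int p = 0" by (metis mod_add_left_eq mod_self)
    moreover have "Suc (nat (k mod int p)) = p" using True p(1)
      by (metis Suc_nat_eq_nat_zadd1 nat_int pos_mod_sign of_nat_0_less_iff add.commute)
    ultimately show ?thesis using p(2) by (metis funpow.simps(2) nat_0 o_apply funpow_0)
  next
    case False
    have b: "0 \<le> k mod int p" "k mod int p < int p" using p(1) by auto
    then have "(k + 1) mod int p = k mod int p + 1"
      using False by (subst mod_add_left_eq[symmetric], intro mod_pos_pos_trivial) auto
    then show ?thesis using b by (simp add: nat_add_distrib)
  qed
qed simp

section \<open>Weighted periods\<close>

text \<open>
  The sum of the weights along one minimal period. This generalizes the minimal period and, in
  contrast to it, is compatible with inducing: the period under $f$ is a weighted period under a
  first return map of $f$, with the return times as weights.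
\<close>

definition weighted_period :: "('a \<Rightarrow> 'a) \<Rightarrow> ('a \<Rightarrow> nat) \<Rightarrow> 'a \<Rightarrow> enat" where
  "weighted_period f \<omega> x =
     (if \<exists>p\<ge>1. (f ^^ p) x = x
      then enat (\<Sum>i<(LEAST p. 1 \<le> p \<and> (f ^^ p) x = x). \<omega> ((f ^^ i) x)) else \<infinity>)"

lemma min_period_weighted: "min_period z = weighted_period Tmap (\<lambda>_. 1) z"
  by (simp add: min_period_def weighted_period_def)

lemma weighted_period_infinite:
  "\<not> (\<exists>p\<ge>1. (f ^^ p) x = x) \<Longrightarrow> weighted_period f \<omega> x = \<infinity>"
  unfolding weighted_period_def by (simp only: if_False)

lemma weighted_period_eq:
  assumes "1 \<le> p" "(f ^^ p) x = x" "\<And>q. 1 \<le> q \<Longrightarrow> (f ^^ q) x = x \<Longrightarrow> p \<le> q"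
  shows "weighted_period f \<omega> x = enat (\<Sum>i<p. \<omega> ((f ^^ i) x))"
proof -
  have "(LEAST p. 1 \<le> p \<and> (f ^^ p) x = x) = p" using assms by (intro Least_equality) auto
  then show ?thesis using assms unfolding weighted_period_def by auto
qed

lemma least_period:
  assumes "1 \<le> p" "(f ^^ p) x = x"
  obtains q where "1 \<le> q" "(f ^^ q) x = x" "\<And>r. 1 \<le> r \<Longrightarrow> (f ^^ r) x = x \<Longrightarrow> q \<le> r"
  using LeastI[of "\<lambda>p. 1 \<le> p \<and> (f ^^ p) x = x" p]
    Least_le[of "\<lambda>p. 1 \<le> p \<and> (f ^^ p) x = x"] assms by blast

lemma least_period_dvd:
  assumes q: "1 \<le> q" "(f ^^ q) x = x" "\<And>r. 1 \<le> r \<Longrightarrow> (f ^^ r) x = x \<Longrightarrow> q \<le> r"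
    and p: "(f ^^ p) x = x"
  shows "q dvd p"
proof -
  have "(f ^^ (p mod q)) x = x" using funpow_mod_eq[OF q(2)] p by metis
  moreover have "p mod q < q" using q(1) by simp
  ultimately have "\<not> 1 \<le> p mod q" using q(3)[of "p mod q"] by linarith
  then show ?thesis by (simp add: dvd_eq_mod_eq_0)
qed

lemma weighted_period_divisors:
  assumes p: "1 \<le> p" "(f ^^ p) x = x" and d: "\<And>d. d dvd p \<Longrightarrow> d < p \<Longrightarrow> (f ^^ d) x \<noteq> x"
  shows "weighted_period f \<omega> x = enat (\<Sum>i<p. \<omega> ((f ^^ i) x))"
proof -
  obtain q where q: "1 \<le> q" "(f ^^ q) x = x" "\<And>r. 1 \<le> r \<Longrightarrow> (f ^^ r) x = x \<Longrightarrow> q \<le> r"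
    using least_period[OF p] by blast
  have "q dvd p" using least_period_dvd[OF q p(2)] .
  then have "q = p" using d[of q] q p(1) by (metis dvd_imp_le le_neq_implies_less less_le_trans zero_less_one)
  then show ?thesis using weighted_period_eq q by metis
qed

lemma weighted_period_cong:
  assumes "f ` X \<subseteq> X" "x \<in> X" "\<And>y. y \<in> X \<Longrightarrow> \<omega> y = \<omega>' y"
  shows "weighted_period f \<omega> x = weighted_period f \<omega>' x"
  using funpow_mem[OF assms(1,2)] assms(3) by (simp add: weighted_period_def)

lemma weighted_period_apply:
  assumes f: "inj_on f X" "f ` X \<subseteq> X" and x: "x \<in> X"
  shows "weighted_period f \<omega> (f x) = weighted_period f \<omega> x"
proof -
  have iff: "(f ^^ p) (f x) = f x \<longleftrightarrow> (f ^^ p) x = x" for p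
    using f(1) funpow_mem[OF f(2) x, of p] x by (simp add: inj_on_eq_iff flip: funpow_swap1)
  show ?thesis
  proof (cases "\<exists>p\<ge>1. (f ^^ p) x = x")
    case True
    then obtain q where q: "1 \<le> q" "(f ^^ q) x = x" "\<And>r. 1 \<le> r \<Longrightarrow> (f ^^ r) x = x \<Longrightarrow> q \<le> r"
      using least_period by metis
    then obtain n where n: "q = Suc n" by (cases q) auto
    have "(\<Sum>i<q. \<omega> ((f ^^ i) (f x))) = (\<Sum>i<Suc n. \<omega> ((f ^^ Suc i) x))"
      by (simp add: n funpow_swap1)
    also have "\<dots> = (\<Sum>i<n. \<omega> ((f ^^ Suc i) x)) + \<omega> x" using q(2) n by simp
    also have "\<dots> = (\<Sum>i<q. \<omega> ((f ^^ i) x))" unfolding n sum.lessThan_Suc_shift by simp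
    finally show ?thesis
      using weighted_period_eq[of q f x \<omega>] weighted_period_eq[of q f "f x" \<omega>] q iff by simp
  next
    case False
    then have "\<not> (\<exists>p\<ge>1. (f ^^ p) (f x) = f x)" using iff by blast
    from weighted_period_infinite[OF this] weighted_period_infinite[OF False] show ?thesis by simp
  qed
qed

lemma weighted_period_int_iter:
  assumes bij: "bij_betw f X X" and x: "x \<in> X"
  shows "weighted_period f \<omega> (int_iter X f k x) = weighted_period f \<omega> x"
proof -
  have "inj_on f X" "f ` X \<subseteq> X" using bij by (auto simp: bij_betw_def)
  then have succ: "weighted_period f \<omega> (int_iter X f (j + 1) x) = weighted_period f \<omega> (int_iter X f j x)" for j
    using weighted_period_apply int_iter_mem[OF bij x] int_iter_succ[OF bij x] by metis
  show ?thesis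
  proof (induction k rule: int_induct[where k = 0])
    case base then show ?case by (simp add: int_iter_def)
  next
    case (step1 i) then show ?case using succ by simp
  next
    case (step2 i) then show ?case using succ[of "i - 1"] by simp
  qed
qed

lemma weighted_period_conj:
  assumes conj: "\<And>x. x \<in> X \<Longrightarrow> h (u x) = u (f x)" and f: "f ` X \<subseteq> X" and u: "inj_on u X"
    and x: "x \<in> X"
  shows "weighted_period h \<omega> (u x) = weighted_period f (\<lambda>y. \<omega> (u y)) x"
proof -
  have p: "(h ^^ n) (u x) = u ((f ^^ n) x)" for n
    by (induction n) (simp_all add: conj funpow_mem[OF f x])
  then have "(h ^^ n) (u x) = u x \<longleftrightarrow> (f ^^ n) x = x" for n
    using u funpow_mem[OF f x] x by (simp add: inj_on_eq_iff)
  with p show ?thesis by (simp add: weighted_period_def)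
qed

text \<open>
  The times $n$ with $f^n(x) \in Y$ are exactly the partial sums $t_k$ of the return times along
  the $g$-orbit of $x$. Hence the periods of $x$ under $f$ are the numbers $t_k$ for the periods
  $k$ of $x$ under $g$, and the weights collected by $f$ up to $t_k$ can be grouped by returns.
\<close>

lemma weighted_period_induced:
  assumes r: "\<And>y. y \<in> Y \<Longrightarrow> 0 < r y" "\<And>y. y \<in> Y \<Longrightarrow> (f ^^ r y) y = g y" "\<And>y. y \<in> Y \<Longrightarrow> g y \<in> Y"
    "\<And>y j. y \<in> Y \<Longrightarrow> 0 < j \<Longrightarrow> j < r y \<Longrightarrow> (f ^^ j) y \<notin> Y"
    and x: "x \<in> Y"
  shows "weighted_period f \<omega> x = weighted_period g (\<lambda>y. \<Sum>i<r y. \<omega> ((f ^^ i) y)) x"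
proof -
  define t where "t k = (\<Sum>i<k. r ((g ^^ i) x))" for k
  have gY: "(g ^^ k) x \<in> Y" for k using funpow_mem[of g Y] r(3) x by blast
  have tSuc: "t (Suc k) = t k + r ((g ^^ k) x)" for k by (simp add: t_def)
  have t0: "t 0 = 0" by (simp add: t_def)
  have fg: "(f ^^ t k) x = (g ^^ k) x" for k
    by (induction k) (simp_all add: t0 tSuc add.commute[of "t _"] funpow_add r(2) gY)
  have mono: "t j < t k" if "j < k" for j k
    using that by (rule lift_Suc_mono_less[rotated]) (simp add: tSuc r(1) gY)
  have hit: "\<exists>k. n = t k" if "(f ^^ n) x \<in> Y" for n
  proof -
    have "n < t (Suc n)"
      by (rule less_le_trans[OF lessI]) (use strict_mono_imp_increasing[of t "Suc n"] mono in \<open>simp add: strict_mono_def\<close>)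
    then have ex: "\<exists>k. n < t k" by blast
    define k where "k = (LEAST k. n < t k)"
    have k: "n < t k" and least: "\<And>j. n < t j \<Longrightarrow> k \<le> j"
      using LeastI_ex[OF ex] Least_le[of "\<lambda>k. n < t k"] unfolding k_def by auto
    then obtain m where m: "k = Suc m" using t0 by (cases k) auto
    then have "t m \<le> n" using least[of m] by (meson not_less_eq_eq not_less order_refl)
    define j where "j = n - t m"
    have n: "n = j + t m" using \<open>t m \<le> n\<close> by (auto simp: j_def)
    have "(f ^^ j) ((g ^^ m) x) \<in> Y" using that by (simp add: n funpow_add fg)
    moreover have "j < r ((g ^^ m) x)" using k m tSuc n by simp
    ultimately have "j = 0" using r(4)[OF gY] by blast
    then show ?thesis using n by auto
  qed
  have sums: "(\<Sum>n<t k. \<omega> ((f ^^ n) x)) = (\<Sum>j<k. \<Sum>i<r ((g ^^ j) x). \<omega> ((f ^^ i) ((g ^^ j) x)))" for k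
  proof (induction k)
    case (Suc k)
    have "(\<Sum>n<t k + m. \<omega> ((f ^^ n) x)) = (\<Sum>n<t k. \<omega> ((f ^^ n) x)) + (\<Sum>i<m. \<omega> ((f ^^ i) ((g ^^ k) x)))" for m
      by (induction m) (simp_all add: add.commute[of "t _"] funpow_add fg)
    then show ?case using Suc by (simp add: tSuc)
  qed (simp add: t0)
  show ?thesis
  proof (cases "\<exists>p\<ge>1. (g ^^ p) x = x")
    case True
    then obtain q where q: "1 \<le> q" "(g ^^ q) x = x" "\<And>r. 1 \<le> r \<Longrightarrow> (g ^^ r) x = x \<Longrightarrow> q \<le> r"
      using least_period by metis
    have "t q \<le> p" if p: "1 \<le> p" "(f ^^ p) x = x" for p
    proof -
      obtain k where k: "p = t k" using hit[of p] p x by auto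
      then have "1 \<le> k" using p t0 by (cases k) auto
      then have "q \<le> k" using q(3) p fg k by metis
      then show ?thesis using mono[of q k] k by (cases "q = k") auto
    qed
    moreover have "1 \<le> t q" using mono[of 0 q] q(1) t0 by simp
    ultimately have "weighted_period f \<omega> x = enat (\<Sum>i<t q. \<omega> ((f ^^ i) x))"
      using fg q(2) by (intro weighted_period_eq) auto
    then show ?thesis using weighted_period_eq[OF q] sums by simp
  next
    case False
    have "\<not> (\<exists>p\<ge>1. (f ^^ p) x = x)"
    proof
      assume "\<exists>p\<ge>1. (f ^^ p) x = x"
      then obtain p where p: "1 \<le> p" "(f ^^ p) x = x" by blast
      obtain k where k: "p = t k" using hit[of p] p x by auto
      then have "1 \<le> k" using p t0 by (cases k) auto
      then show False using False fg k p by metis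
    qed
    from weighted_period_infinite[OF this] weighted_period_infinite[OF False] show ?thesis by simp
  qed
qed

lemma weighted_period_ge:
  assumes f: "f ` X \<subseteq> X" "x \<in> X" and c: "\<And>y. y \<in> X \<Longrightarrow> c \<le> \<omega> y"
  shows "enat c \<le> weighted_period f \<omega> x"
proof (cases "\<exists>p\<ge>1. (f ^^ p) x = x")
  case True
  then obtain q where q: "1 \<le> q" "(f ^^ q) x = x" "\<And>r. 1 \<le> r \<Longrightarrow> (f ^^ r) x = x \<Longrightarrow> q \<le> r"
    using least_period by metis
  have "\<omega> ((f ^^ 0) x) \<le> (\<Sum>i<q. \<omega> ((f ^^ i) x))"
    using q(1) by (intro member_le_sum) auto
  then show ?thesis using weighted_period_eq[OF q, of \<omega>] c[OF f(2)] by simp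
next
  case False
  from weighted_period_infinite[OF this] show ?thesis by simp
qed

section \<open>The map T\<close>

text \<open>
  The inverse is obtained by exchanging the roles of the outer two of the three consecutive
  coordinates $x$, $y$, $\{-x-y/\gamma\}$, because their relation is symmetric.
\<close>

lemma bij_Tmap: "bij_betw Tmap unit_square unit_square"
proof (rule bij_betw_imageI)
  show "inj_on Tmap unit_square"
  proof (rule inj_onI, clarify)
    fix x y x' y'
    assume a: "(x, y) \<in> unit_square" "(x', y') \<in> unit_square" "Tmap (x, y) = Tmap (x', y')"
    then have y: "y = y'" and f: "frac (- x - y / \<gamma>) = frac (- x' - y / \<gamma>)" by (auto simp: Tmap_def)
    from f have "x' - x = of_int (\<lfloor>- x - y / \<gamma>\<rfloor> - \<lfloor>- x' - y / \<gamma>\<rfloor>)" by (simp add: frac_def)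
    then obtain k :: int where k: "x' - x = of_int k" by blast
    have "\<bar>of_int k\<bar> < (1::real)" using a by (auto simp: unit_square_def k[symmetric])
    then have "k = 0" by linarith
    with k y show "x = x' \<and> y = y'" by simp
  qed
  show "Tmap ` unit_square = unit_square"
  proof (intro equalityI subsetI)
    fix z assume "z \<in> unit_square"
    then obtain u v where z: "z = (u, v)" "0 \<le> u" "u < 1" "0 \<le> v" "v < 1"
      by (auto simp: unit_square_def)
    let ?x = "frac (- v - u / \<gamma>)"
    have "frac (- ?x - u / \<gamma>) = v"
      by (subst frac_unique_iff) (use z in \<open>simp add: frac_def algebra_simps\<close>)
    then have "Tmap (?x, u) = z" by (simp add: Tmap_def z)
    moreover have "(?x, u) \<in> unit_square" using z by (simp add: unit_square_def frac_lt_1)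
    ultimately show "z \<in> Tmap ` unit_square" by (metis image_eqI)
  qed (auto simp: Tmap_def unit_square_def frac_lt_1)
qed

lemma inj_Tmap: "inj_on Tmap unit_square" and Tmap_square: "Tmap ` unit_square \<subseteq> unit_square"
  using bij_Tmap by (auto simp: bij_betw_def)

lemma min_period_funpow:
  assumes "z \<in> unit_square" shows "min_period ((Tmap ^^ n) z) = min_period z"
proof (induction n)
  case (Suc n)
  then show ?case
    using weighted_period_apply[OF inj_Tmap Tmap_square funpow_mem[OF Tmap_square assms]]
    by (simp add: min_period_weighted)
qed simp

section \<open>The first return map to D\<close>

definition D_poly :: "halfplane list" where
  "D_poly = [((-1,0), (1,0), (0,0), True), ((0,0), (-1,0), (1,0), True), ((1,1), (1,0), (-3,1), False)]"

definition D0_poly :: "halfplane list" where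
  "D0_poly = ((1,0), (0,0), (-4,5), True) # D_poly"

definition D1_poly :: "halfplane list" where
  "D1_poly = ((-1,0), (0,0), (4,-5), False) # D_poly"

lemma Dset_region: "Dset = region D_poly"
proof -
  have "(x, y) \<in> Dset \<longleftrightarrow> (x, y) \<in> region D_poly" for x y :: real
  proof -
    have "(x, y) \<in> region D_poly \<longleftrightarrow> x < y \<and> y < 1 \<and> 4 - \<gamma> \<le> \<gamma> * x + y"
      by (auto simp: region_def D_poly_def holds_def gamma_tau algebra_simps)
    moreover have "0 \<le> x" if "y < 1" "4 - \<gamma> \<le> \<gamma> * x + y"
    proof -
      have "0 < \<gamma> * x" "0 < \<gamma>" using that tau_bounds by (simp_all add: gamma_tau)
      then show ?thesis by (simp add: zero_less_mult_iff)
    qed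
    ultimately show ?thesis by (auto simp: Dset_def unit_square_def)
  qed
  then show ?thesis by auto
qed

lemma D0_region: "D0 = region D0_poly"
proof -
  have "(x, y) \<in> D0 \<longleftrightarrow> (x, y) \<in> region D0_poly" for x y :: real
    unfolding D0_def Dset_region tau_gamma by (auto simp: region_def D0_poly_def holds_def)
  then show ?thesis by auto
qed

lemma D1_region: "D1 = region D1_poly"
proof -
  have "(x, y) \<in> D1 \<longleftrightarrow> (x, y) \<in> region D1_poly" for x y :: real
    unfolding D1_def Dset_region tau_gamma by (auto simp: region_def D1_poly_def holds_def)
  then show ?thesis by auto
qed

lemma D_split: "D0 \<union> D1 = Dset" "D0 \<inter> D1 = {}" "D0 \<subseteq> Dset" "D1 \<subseteq> Dset"
  by (auto simp: D0_def D1_def)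

lemma Dset_square: "Dset \<subseteq> unit_square"
  by (auto simp: Dset_def)

text \<open>
  The itineraries of the first returns of $D_1$ and $D_0$ to $\mathcal D$. After $14$ steps
  $D_0$ has reached a triangle that together with $D_1$ forms a larger triangle, which then returns
  as a whole; so the longer word ends in the shorter one.
\<close>

definition W1 :: "int list" where
  "W1 = [2,2,1,1,1,1,1,1,1,2,2,2,2,1,1,1,1,2,1,2,1,2,1,1,1,1,2,2]"

definition W0 :: "int list" where
  "W0 = [2,2,1,1,1,1,1,1,1,2,2,2,2,2] @ W1"

lemma length_W [simp]: "length W0 = 42" "length W1 = 28"
  by (simp_all add: W0_def W1_def)

lemma return_D0: "returns D0_poly W0 D_poly" by code_simp

lemma return_D1: "returns D1_poly W1 D_poly" by code_simp

lemma That_first_return: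
  assumes "0 < n" "(Tmap ^^ n) z \<in> Dset" "\<And>j. 0 < j \<Longrightarrow> j < n \<Longrightarrow> (Tmap ^^ j) z \<notin> Dset"
  shows "That z = (Tmap ^^ n) z"
proof -
  obtain m where m: "n = Suc m" using assms(1) by (cases n) auto
  have s: "(Tmap ^^ j) (Tmap z) = (Tmap ^^ Suc j) z" for j by (simp add: funpow_swap1)
  have "(LEAST j. (Tmap ^^ j) (Tmap z) \<in> Dset) = m"
  proof (rule Least_equality)
    show "(Tmap ^^ m) (Tmap z) \<in> Dset" using assms(2) by (simp only: s m)
  next
    fix j assume "(Tmap ^^ j) (Tmap z) \<in> Dset"
    then show "m \<le> j" using assms(3)[of "Suc j"] unfolding s m by fastforce
  qed
  then show ?thesis unfolding That_def Rmap_def by (simp only: s m)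
qed

fun branch_poly :: "bool \<Rightarrow> halfplane list" where
  "branch_poly e = (if e then D0_poly else D1_poly)"

fun branch_word :: "bool \<Rightarrow> int list" where
  "branch_word e = (if e then W0 else W1)"

lemma branch_word_nonempty: "branch_word e \<noteq> []"
  by (simp add: W0_def W1_def)

text \<open>
  The value True selects $D_0$ and the value False selects $D_1$.
\<close>

definition branch_set :: "bool \<Rightarrow> (real \<times> real) set" where
  "branch_set e = (if e then D0 else D1)"

lemma branch_region: "branch_set e = region (branch_poly e)"
  by (simp add: branch_set_def D0_region D1_region)

lemma branch_cases: assumes "z \<in> Dset" obtains e where "z \<in> branch_set e"
  using assms D_split(1) that[of True] that[of False] by (auto simp: branch_set_def)

lemma branch_set_Dset: "branch_set e \<subseteq> Dset"
  using D_split by (simp add: branch_set_def)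

lemma branch_D0: "z \<in> branch_set e \<Longrightarrow> z \<in> D0 \<longleftrightarrow> e"
  using D_split(2) by (auto simp: branch_set_def split: if_splits)

lemma branch_returns: "returns (branch_poly e) (branch_word e) D_poly"
  using return_D0 return_D1 by simp

lemma That_branch:
  assumes "z \<in> branch_set e"
  shows "That z = run (branch_word e) z" "That z \<in> Dset" "(Tmap ^^ length (branch_word e)) z = That z"
    "\<And>j. 0 < j \<Longrightarrow> j < length (branch_word e) \<Longrightarrow> (Tmap ^^ j) z \<notin> Dset"
proof -
  have z: "z \<in> region (branch_poly e)" using assms by (simp add: branch_region)
  note r = returns_sound[OF branch_returns z]
  have "That z = (Tmap ^^ length (branch_word e)) z"
    using r branch_word_nonempty by (intro That_first_return) (auto simp: Dset_region simp del: branch_word.simps)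
  then show "That z = run (branch_word e) z" "That z \<in> Dset" "(Tmap ^^ length (branch_word e)) z = That z"
    "\<And>j. 0 < j \<Longrightarrow> j < length (branch_word e) \<Longrightarrow> (Tmap ^^ j) z \<notin> Dset"
    using r by (simp_all add: Dset_region del: branch_word.simps)
qed

definition return_time :: "real \<times> real \<Rightarrow> nat" where
  "return_time z = (if z \<in> D0 then 42 else 28)"

lemma return_time_branch: "z \<in> branch_set e \<Longrightarrow> return_time z = length (branch_word e)"
  by (simp add: return_time_def branch_D0)

lemma return_time:
  assumes "z \<in> Dset"
  shows "0 < return_time z" "(Tmap ^^ return_time z) z = That z" "That z \<in> Dset"
    "\<And>j. 0 < j \<Longrightarrow> j < return_time z \<Longrightarrow> (Tmap ^^ j) z \<notin> Dset"
proof -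
  obtain e where e: "z \<in> branch_set e" using branch_cases[OF assms] .
  show "0 < return_time z" by (simp add: return_time_def)
  show "(Tmap ^^ return_time z) z = That z" "That z \<in> Dset"
    "\<And>j. 0 < j \<Longrightarrow> j < return_time z \<Longrightarrow> (Tmap ^^ j) z \<notin> Dset"
    using That_branch[OF e] return_time_branch[OF e] by auto
qed

lemma D_image_cover:
  "covers [imgs W0 D0_poly, imgs W1 D1_poly] (Cut ((0,1),(1,0),(-4,4),True) (Piece 0) (Piece 1)) D_poly"
  by code_simp

text \<open>
  A first return map of an injective map is injective. It is onto because the images of $D_0$
  and $D_1$ fill $\mathcal D$; the cut between them is the line $x/\gamma + y = 4 - 4/\gamma$.
\<close>

lemma bij_That: "bij_betw That Dset Dset"
proof (rule bij_betw_imageI)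
  have *: "z = w" if z: "z \<in> Dset" "w \<in> Dset" "That z = That w" and le: "return_time z \<le> return_time w" for z w
  proof -
    define d where "d = return_time w - return_time z"
    have "(Tmap ^^ return_time z) z = (Tmap ^^ return_time z) ((Tmap ^^ d) w)"
      using return_time(2)[OF z(1)] return_time(2)[OF z(2)] z(3) le
      by (simp add: d_def flip: funpow_add[THEN fun_cong, unfolded o_apply])
    moreover have "inj_on (Tmap ^^ return_time z) unit_square"
      using bij_betw_funpow[OF bij_Tmap] by (simp add: bij_betw_def)
    moreover have "z \<in> unit_square" "(Tmap ^^ d) w \<in> unit_square"
      using z Dset_square funpow_mem[OF Tmap_square, of w d] by auto
    ultimately have zw: "z = (Tmap ^^ d) w" by (simp add: inj_on_eq_iff)
    have "d < return_time w" using return_time(1)[OF z(1)] return_time(1)[OF z(2)] by (simp add: d_def)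
    then have "d = 0" using return_time(4)[OF z(2), of d] zw z(1) by auto
    with zw show ?thesis by simp
  qed
  show "inj_on That Dset"
    by (rule inj_onI) (metis * nat_le_linear)
  show "That ` Dset = Dset"
  proof (intro equalityI subsetI)
    fix z assume "z \<in> Dset"
    then have "z \<in> region (imgs (branch_word True) (branch_poly True)) \<or> z \<in> region (imgs (branch_word False) (branch_poly False))"
      using covers_sound[OF D_image_cover] by (simp add: Dset_region)
    then obtain e u where "u \<in> region (branch_poly e)" "z = run (branch_word e) u" by (metis region_imgsE)
    then have u: "u \<in> branch_set e" "z = That u" using That_branch(1) by (simp_all add: branch_region)
    then show "z \<in> That ` Dset" using branch_set_Dset by blast
  qed (use return_time(3) in auto)
qed

lemma That_Dset: "That ` Dset \<subseteq> Dset"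
  using bij_That by (simp add: bij_betw_def)

definition letter_weight :: "nat \<Rightarrow> nat \<Rightarrow> real \<times> real \<Rightarrow> nat" where
  "letter_weight a b z = (if z \<in> D0 then a else b)"

lemma min_period_Dset:
  assumes "z \<in> Dset" shows "min_period z = weighted_period That (letter_weight 42 28) z"
proof -
  have "min_period z = weighted_period That (\<lambda>w. \<Sum>i<return_time w. 1) z"
    unfolding min_period_weighted by (rule weighted_period_induced[OF return_time assms])
  then show ?thesis by (simp add: return_time_def letter_weight_def[abs_def])
qed

section \<open>Self-similarity of the first return map\<close>

definition flow :: "bool \<Rightarrow> halfplane list \<Rightarrow> halfplane list" where
  "flow e P = imgs (branch_word e) P"

text \<open>
  The analogue of the first-return test for $\hat T$ in place of $T$, with words over the two
  branches.
\<close>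

fun hat_returns :: "halfplane list \<Rightarrow> bool list \<Rightarrow> halfplane list \<Rightarrow> bool" where
  "hat_returns P [] S \<longleftrightarrow> inside P S"
| "hat_returns P (e # v) S \<longleftrightarrow> inside P (branch_poly e) \<and> (v = [] \<or> apart (flow e P) S) \<and>
     hat_returns (flow e P) v S"

lemma hat_returns_sound:
  assumes "hat_returns P v S" "z \<in> region P"
  shows "(That ^^ length v) z = run (concat (map branch_word v)) z \<and> (That ^^ length v) z \<in> region S
    \<and> (\<forall>j<length v. (That ^^ j) z \<in> branch_set (v ! j))
    \<and> (\<forall>j. 0 < j \<and> j < length v \<longrightarrow> (That ^^ j) z \<notin> region S)"
  using assms
proof (induction P v S arbitrary: z rule: hat_returns.induct)
  case (1 P S)
  then show ?case using inside_sound by auto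
next
  case (2 P e v S)
  have z: "z \<in> branch_set e" using 2(2,3) inside_sound[of P "branch_poly e"] by (auto simp: branch_region simp del: branch_poly.simps)
  have t: "That z = run (branch_word e) z" using That_branch(1)[OF z] .
  have flow: "That z \<in> region (flow e P)" using 2(3) by (simp add: t flow_def region_imgs)
  have r: "hat_returns (flow e P) v S" and ap: "v = [] \<or> apart (flow e P) S" using 2(2) by auto
  note IH = 2(1)[OF r flow]
  have s: "(That ^^ Suc j) z = (That ^^ j) (That z)" for j by (simp add: funpow_swap1)
  have c1: "\<forall>j<length (e # v). (That ^^ j) z \<in> branch_set ((e # v) ! j)"
  proof (intro allI impI)
    fix j assume "j < length (e # v)"
    then show "(That ^^ j) z \<in> branch_set ((e # v) ! j)"
      using IH z s by (cases j) (auto simp del: funpow.simps(2))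
  qed
  have c2: "(That ^^ j) z \<notin> region S" if j: "0 < j" "j < length (e # v)" for j
  proof (cases "j = 1")
    case True
    then show ?thesis using apart_sound ap flow j by auto
  next
    case False
    then obtain i where "j = Suc i" "0 < i" using j by (cases j) auto
    then show ?thesis using IH s j by (simp del: funpow.simps(2))
  qed
  have last: "(That ^^ length (e # v)) z = (That ^^ length v) (run (branch_word e) z)"
    using s[of "length v"] t by simp
  have "(That ^^ length (e # v)) z = run (concat (map branch_word (e # v))) z"
    using IH[unfolded t, THEN conjunct1] unfolding last by (simp add: run_append del: branch_word.simps)
  moreover have "(That ^^ length (e # v)) z \<in> region S"
    using IH[unfolded t, THEN conjunct2, THEN conjunct1] by (simp only: last)
  moreover note c1 c2
  ultimately show ?case by blast
qed

lemma Umap_eq: "Umap (x, y) = ((1 - \<tau>) * x + \<tau>, (1 - \<tau>) * y + \<tau>)"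
  by (simp add: Umap_def tau_gamma)

text \<open>
  The image of a half-plane under $U$. Since $U^{-1}(z) = \gamma^2 (z - (\tau,\tau))$, the form
  is multiplied by $\tau^2 = 1 - \tau$ to keep the normal vector.
\<close>

fun uimg :: "halfplane \<Rightarrow> halfplane" where
  "uimg (m, n, c, s) = (m, n, gsub (gsub c (gmul_tau c)) (gmul_tau (gadd m n)), s)"

lemma holds_uimg: "holds (uimg k) (Umap z) = holds k z"
proof -
  obtain m n c s x y where k: "k = (m, n, c, s)" "z = (x, y)" by (metis surj_pair)
  have "lin (uimg k) (Umap z) = (1 - \<tau>) * lin k z"
    by (simp add: k Umap_eq algebra_simps)
  moreover have "strict (uimg k) = strict k" by (simp add: k)
  moreover have "0 < 1 - \<tau>" using tau_bounds by simp
  ultimately show ?thesis by (simp add: holds_def zero_le_mult_iff)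
qed

lemma bij_Umap: "bij Umap"
proof (rule bijI)
  have "1 - \<tau> \<noteq> 0" using tau_bounds by simp
  then show "inj Umap" by (auto intro!: injI simp: Umap_eq)
  have "Umap ((u - \<tau>) / (1 - \<tau>), (v - \<tau>) / (1 - \<tau>)) = (u, v)" for u v
    using \<open>1 - \<tau> \<noteq> 0\<close> by (simp add: Umap_eq)
  then show "surj Umap" unfolding surj_def by (metis surj_pair)
qed

lemma Umap_region: "Umap ` region P = region (map uimg P)"
proof
  show "Umap ` region P \<subseteq> region (map uimg P)"
    by (auto simp: region_def holds_uimg simp del: uimg.simps)
  show "region (map uimg P) \<subseteq> Umap ` region P"
  proof
    fix z assume z: "z \<in> region (map uimg P)"
    obtain w where "z = Umap w" using bij_Umap by (meson bij_pointE)
    with z show "z \<in> Umap ` region P" by (auto simp: region_def holds_uimg simp del: uimg.simps)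
  qed
qed

fun uform :: "golden \<times> golden \<times> golden \<Rightarrow> golden \<times> golden \<times> golden" where
  "uform (m, n, c) = (gsub m (gmul_tau m), gsub n (gmul_tau n), gadd (gsub c (gmul_tau c)) (0,1))"

fun uaffine :: "affine \<Rightarrow> affine" where
  "uaffine (p, q) = (uform p, uform q)"

lemma affine_map_uaffine: "affine_map (uaffine f) z = Umap (affine_map f z)"
proof -
  obtain m n c m' n' c' where f: "f = ((m, n, c), (m', n', c'))" by (metis surj_pair)
  show ?thesis by (cases z) (simp add: f affine_map_def Umap_eq algebra_simps)
qed

text \<open>
  The branches that $U(D_0)$ and $U(D_1)$ visit before they return to $U(\mathcal D)$. As a
  substitution this is $0 \mapsto 010$, $1 \mapsto 01110$, with incidence matrix
  $\left(\begin{array}{cc} 2 & 1 \cr 2 & 3 \end{array}\right)$ of eigenvalues $4$ and $1$.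
\<close>

definition substitution :: "bool \<Rightarrow> bool list" where
  "substitution e = (if e then [True, False, True] else [True, False, False, False, True])"

lemma hat_return_U0: "hat_returns (map uimg D0_poly) [True, False, True] (map uimg D_poly)" by code_simp

lemma hat_return_U1: "hat_returns (map uimg D1_poly) [True, False, False, False, True] (map uimg D_poly)" by code_simp

lemma hat_return_U: "hat_returns (map uimg (branch_poly e)) (substitution e) (map uimg D_poly)"
  using hat_return_U0 hat_return_U1 by (simp add: substitution_def)

text \<open>
  The affine identity behind self-similarity: the composition of the branches along the
  substituted word is the conjugate under $U$ of a single branch.
\<close>

lemma substitution_affine:
  "arun (concat (map branch_word (substitution e))) (uaffine ident) = uaffine (arun (branch_word e) ident)"
proof -
  have "arun (concat (map branch_word (substitution True))) (uaffine ident) = uaffine (arun (branch_word True) ident)"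
    by code_simp
  moreover have "arun (concat (map branch_word (substitution False))) (uaffine ident) = uaffine (arun (branch_word False) ident)"
    by code_simp
  ultimately show ?thesis by (cases e) simp_all
qed

lemma run_substitution: "run (concat (map branch_word (substitution e))) (Umap z) = Umap (run (branch_word e) z)"
  using affine_map_arun[of "concat (map branch_word (substitution e))" "uaffine ident" z]
  by (simp only: substitution_affine affine_map_uaffine affine_map_arun affine_map_ident)

lemma That_Umap:
  assumes "w \<in> branch_set e"
  shows "(That ^^ length (substitution e)) (Umap w) = Umap (That w)"
    "\<And>j. j < length (substitution e) \<Longrightarrow> (That ^^ j) (Umap w) \<in> branch_set (substitution e ! j)"
    "\<And>j. 0 < j \<Longrightarrow> j < length (substitution e) \<Longrightarrow> (That ^^ j) (Umap w) \<notin> Umap ` Dset"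
proof -
  have "Umap w \<in> region (map uimg (branch_poly e))"
    using assms by (auto simp: branch_region simp flip: Umap_region)
  note h = hat_returns_sound[OF hat_return_U this]
  show "(That ^^ length (substitution e)) (Umap w) = Umap (That w)"
    using h run_substitution That_branch(1)[OF assms] by simp
  show "\<And>j. j < length (substitution e) \<Longrightarrow> (That ^^ j) (Umap w) \<in> branch_set (substitution e ! j)"
    using h by blast
  show "\<And>j. 0 < j \<Longrightarrow> j < length (substitution e) \<Longrightarrow> (That ^^ j) (Umap w) \<notin> Umap ` Dset"
    using h by (simp add: Dset_region Umap_region)
qed

text \<open>
  The first return map of $\hat T$ to $U(\mathcal D)$ is $U \hat T U^{-1}$. Passing from $U(w)$
  to $w$ therefore replaces the weights $a$, $b$ of the two branches by the weights of the
  substituted words.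
\<close>

lemma weighted_period_Umap:
  assumes "w \<in> Dset"
  shows "weighted_period That (letter_weight a b) (Umap w)
    = weighted_period That (letter_weight (2 * a + b) (2 * a + 3 * b)) w"
proof -
  define r where "r v = (if v \<in> Umap ` D0 then 3 else 5 :: nat)" for v
  have r: "r (Umap u) = length (substitution e)" if "u \<in> branch_set e" for u e
    using branch_D0[OF that] inj_image_mem_iff[OF bij_is_inj[OF bij_Umap]] by (simp add: r_def substitution_def)
  define h where "h v = (That ^^ r v) v" for v
  have hU: "h (Umap u) = Umap (That u)" if u: "u \<in> Dset" for u
  proof -
    obtain e where e: "u \<in> branch_set e" using branch_cases[OF u] .
    show ?thesis using That_Umap(1)[OF e] r[OF e] by (simp add: h_def)
  qed
  define \<omega> where "\<omega> v = (\<Sum>i<r v. letter_weight a b ((That ^^ i) v))" for v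
  have \<omega>: "\<omega> (Umap u) = letter_weight (2 * a + b) (2 * a + 3 * b) u" if u: "u \<in> Dset" for u
  proof -
    obtain e where e: "u \<in> branch_set e" using branch_cases[OF u] .
    have "\<omega> (Umap u) = (\<Sum>i<length (substitution e). if substitution e ! i then a else b)"
      unfolding \<omega>_def r[OF e] using branch_D0[OF That_Umap(2)[OF e]]
      by (intro sum.cong) (simp_all add: letter_weight_def)
    also have "\<dots> = (if e then 2 * a + b else 2 * a + 3 * b)"
      by (simp add: substitution_def eval_nat_numeral)
    finally show ?thesis using branch_D0[OF e] by (simp add: letter_weight_def)
  qed
  have "weighted_period That (letter_weight a b) (Umap w) = weighted_period h \<omega> (Umap w)"
    unfolding \<omega>_def
  proof (rule weighted_period_induced[where Y = "Umap ` Dset"])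
    show "0 < r y" for y by (simp add: r_def)
    show "(That ^^ r y) y = h y" for y by (simp add: h_def)
    show "h y \<in> Umap ` Dset" if "y \<in> Umap ` Dset" for y
      using that hU That_Dset by auto
    show "(That ^^ j) y \<notin> Umap ` Dset" if y: "y \<in> Umap ` Dset" "0 < j" "j < r y" for y j
    proof -
      obtain u where u: "y = Umap u" "u \<in> Dset" using y(1) by blast
      obtain e where e: "u \<in> branch_set e" using branch_cases[OF u(2)] .
      show ?thesis using That_Umap(3)[OF e] r[OF e] y u by simp
    qed
    show "Umap w \<in> Umap ` Dset" using assms by blast
  qed
  also have "\<dots> = weighted_period That (\<lambda>u. \<omega> (Umap u)) w"
    using hU That_Dset assms inj_on_subset[OF bij_is_inj[OF bij_Umap], of Dset]
    by (intro weighted_period_conj[where X = Dset]) auto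
  also have "\<dots> = weighted_period That (letter_weight (2 * a + b) (2 * a + 3 * b)) w"
    by (rule weighted_period_cong[OF That_Dset assms \<omega>])
  finally show ?thesis .
qed

section \<open>The pentagons on which the first return map stays in one branch\<close>

definition stay :: "bool \<Rightarrow> (real \<times> real) set" where
  "stay e = (if e then D_alpha else D_beta)"

lemma stay_iff: "z \<in> stay e \<longleftrightarrow> z \<in> Dset \<and> (\<forall>k. That_iter k z \<in> branch_set e)"
  by (simp add: stay_def branch_set_def D_alpha_def D_beta_def)

text \<open>
  The pentagons $D_\alpha$ and $D_\beta$, found by intersecting the five copies of $D_0$ and of
  $D_1$ under the rotation about the center and dropping redundant half-planes.
\<close>

definition alpha_poly :: "halfplane list" where
  "alpha_poly = [((0,0),(-1,0),(1,0),True), ((1,0),(1,1),(0,-4),True), ((1,1),(0,0),(1,-4),True),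
    ((-1,0),(1,0),(0,0),True), ((-2,-1),(-1,-1),(1,5),True)]"

definition beta_poly :: "halfplane list" where
  "beta_poly = [((1,0),(0,1),(1,-4),False), ((-1,0),(-1,-1),(0,4),False), ((0,0),(2,1),(0,-4),False),
    ((-1,-1),(0,0),(-1,4),False), ((2,1),(-2,-1),(-1,2),False)]"

lemma alpha_inv: "inside alpha_poly D0_poly" "inside (imgs W0 alpha_poly) alpha_poly" by code_simp+

lemma beta_inv: "inside beta_poly D1_poly" "inside (imgs W1 beta_poly) beta_poly" by code_simp+

definition stay_poly :: "bool \<Rightarrow> halfplane list" where
  "stay_poly e = (if e then alpha_poly else beta_poly)"

lemma stay_poly_inside:
  "region (stay_poly e) \<subseteq> branch_set e" "region (imgs (branch_word e) (stay_poly e)) \<subseteq> region (stay_poly e)"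
  using alpha_inv beta_inv inside_sound by (simp_all add: stay_poly_def branch_region)

text \<open>
  The lengths $42$ and $28$ of the words are $2$ and $8$ modulo $10$, so both branches are
  conjugate to rotations of order five.
\<close>

lemma run_order_five: "run (concat (replicate 5 (branch_word e))) z = z"
proof -
  have "arun (concat (replicate 5 (branch_word True))) ident = ident" by code_simp
  moreover have "arun (concat (replicate 5 (branch_word False))) ident = ident" by code_simp
  ultimately have "arun (concat (replicate 5 (branch_word e))) ident = ident" by (cases e) simp_all
  then show ?thesis unfolding run_affine by simp
qed

lemma run_funpow: "run (concat (replicate n w)) z = (run w ^^ n) z"
  by (induction n arbitrary: z) (simp_all add: run_append funpow_swap1)

lemma run_five: "(run (branch_word e) ^^ 5) z = z"
  using run_order_five by (simp only: run_funpow)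

lemma That_iterates:
  assumes "\<And>j. j < n \<Longrightarrow> (run (branch_word e) ^^ j) z \<in> branch_set e" "j \<le> n"
  shows "(That ^^ j) z = (run (branch_word e) ^^ j) z"
  using assms(2)
proof (induction j)
  case (Suc j)
  then have "(That ^^ j) z = (run (branch_word e) ^^ j) z" "(run (branch_word e) ^^ j) z \<in> branch_set e"
    using assms(1)[of j] by simp_all
  then show ?case using That_branch(1) by simp
qed simp

lemma stay_characterization:
  "z \<in> stay e \<longleftrightarrow> (\<forall>j<5. (run (branch_word e) ^^ j) z \<in> branch_set e)"
proof
  assume z: "z \<in> stay e"
  have That: "(That ^^ j) z \<in> branch_set e" for j
    using z int_iter_of_nat[of Dset That j z] unfolding stay_iff by metis
  have "(That ^^ j) z = (run (branch_word e) ^^ j) z" for j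
  proof (induction j)
    case (Suc j)
    then show ?case using That_branch(1)[OF That[of j]] by simp
  qed simp
  with That show "\<forall>j<5. (run (branch_word e) ^^ j) z \<in> branch_set e" by metis
next
  assume h: "\<forall>j<5. (run (branch_word e) ^^ j) z \<in> branch_set e"
  have t: "(That ^^ j) z = (run (branch_word e) ^^ j) z" if "j \<le> 5" for j
    using That_iterates[of 5 e z j] h that by blast
  have "z \<in> branch_set e" using h[rule_format, of 0] by simp
  then have z: "z \<in> Dset" using branch_set_Dset by blast
  have "(That ^^ 5) z = z" using t run_five by simp
  from int_iter_periodic[OF bij_That z _ this]
  have k: "That_iter k z = (That ^^ nat (k mod 5)) z" for k by simp
  have "nat (k mod 5) < 5" for k :: int
    by (simp add: nat_less_iff)
  then have "That_iter k z \<in> branch_set e" for k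
    using k[of k] t[of "nat (k mod 5)"] h by (simp add: less_imp_le)
  with z show "z \<in> stay e" by (simp add: stay_iff)
qed

lemma stay_poly_stay: "region (stay_poly e) \<subseteq> stay e"
proof
  fix z assume z: "z \<in> region (stay_poly e)"
  have "(run (branch_word e) ^^ j) z \<in> region (stay_poly e)" for j
  proof (induction j)
    case (Suc j)
    then have "run (branch_word e) ((run (branch_word e) ^^ j) z) \<in> region (imgs (branch_word e) (stay_poly e))"
      by (simp only: region_imgs)
    then show ?case using stay_poly_inside(2)[of e] by auto
  qed (simp add: z)
  then show "z \<in> stay e"
    unfolding stay_characterization using stay_poly_inside(1) by blast
qed

lemma stay_iterates:
  assumes "z \<in> stay e" "j \<le> 5"
  shows "(That ^^ j) z = (run (branch_word e) ^^ j) z"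
  using assms That_iterates[of 5 e z j] unfolding stay_characterization by blast

lemma stay_branch: "z \<in> stay e \<Longrightarrow> j < 5 \<Longrightarrow> (That ^^ j) z \<in> branch_set e"
  using stay_iterates[of z e j] unfolding stay_characterization by simp

text \<open>
  Five times the fixed point of the branch: the fixed points have denominator $5$ and
  are not golden integers themselves.
\<close>

fun center5 :: "bool \<Rightarrow> golden \<times> golden" where
  "center5 e = (if e then ((9,-7), (16,-18)) else ((2,4), (-2,11)))"

definition center :: "bool \<Rightarrow> real \<times> real" where
  "center e = (gval (fst (center5 e)) / 5, gval (snd (center5 e)) / 5)"

fun orbit_sum :: "nat \<Rightarrow> int list \<Rightarrow> affine" where
  "orbit_sum 0 w = (((0,0), (0,0), (0,0)), ((0,0), (0,0), (0,0)))"
| "orbit_sum (Suc n) w = aadd (orbit_sum n w) (arun (concat (replicate n w)) ident)"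

lemma affine_map_orbit_sum: "affine_map (orbit_sum n w) z = (\<Sum>j<n. (run w ^^ j) z)"
proof (induction n)
  case 0
  show ?case by (cases z) (simp add: affine_map_def zero_prod_def)
next
  case (Suc n)
  then show ?case by (simp add: affine_map_aadd affine_map_arun run_funpow)
qed

text \<open>
  The nontrivial fifth roots of unity and $1$ sum to zero, so the sum over an orbit of length
  five is a constant map, five times the fixed point.
\<close>

lemma sum_five: "(\<Sum>j<5. (run (branch_word e) ^^ j) z) = 5 *\<^sub>R center e"
proof -
  let ?c = "\<lambda>e. (((0,0), (0,0), fst (center5 e)), ((0,0), (0,0), snd (center5 e)))"
  have "orbit_sum 5 (branch_word True) = ?c True" by code_simp
  moreover have "orbit_sum 5 (branch_word False) = ?c False" by code_simp
  ultimately have "orbit_sum 5 (branch_word e) = ?c e" by (cases e) simp_all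
  then have "(\<Sum>j<5. (run (branch_word e) ^^ j) z) = affine_map (?c e) z"
    using affine_map_orbit_sum by metis
  then show ?thesis by (cases z) (simp add: affine_map_def center_def)
qed

lemma run_fixed_center: assumes "run (branch_word e) z = z" shows "z = center e"
proof -
  have "(run (branch_word e) ^^ j) z = z" for j using assms by (induction j) simp_all
  then have "5 *\<^sub>R z = 5 *\<^sub>R center e" using sum_five[of e z] by (simp add: sum_constant_scaleR)
  then show ?thesis by simp
qed

fun eval5 :: "golden \<times> golden \<times> golden \<Rightarrow> golden \<times> golden \<Rightarrow> golden" where
  "eval5 (m, n, c) (x, y) = gadd (gadd (gmul m x) (gmul n y)) (gmul (5,0) c)"

lemma affine_form_center:
  "affine_form p (center e) = gval (eval5 p (center5 e)) / 5"
proof -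
  obtain m n c where p: "p = (m, n, c)" by (metis surj_pair)
  show ?thesis by (cases "center5 e") (simp add: p center_def add_divide_distrib del: center5.simps)
qed

lemma run_center: "run (branch_word e) (center e) = center e"
proof -
  let ?f = "\<lambda>e. arun (branch_word e) ident"
  have "(eval5 (fst (?f True)) (center5 True), eval5 (snd (?f True)) (center5 True)) = center5 True"
    by code_simp
  moreover have "(eval5 (fst (?f False)) (center5 False), eval5 (snd (?f False)) (center5 False)) = center5 False"
    by code_simp
  ultimately have "(eval5 (fst (?f e)) (center5 e), eval5 (snd (?f e)) (center5 e)) = center5 e"
    by (cases e) (simp_all only:)
  then have "eval5 (fst (?f e)) (center5 e) = fst (center5 e)"
    "eval5 (snd (?f e)) (center5 e) = snd (center5 e)"
    by (metis fst_conv, metis snd_conv)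
  then show ?thesis
    unfolding run_affine affine_map_def affine_form_center
    by (simp add: center_def del: center5.simps branch_word.simps)
qed

fun half_form :: "halfplane \<Rightarrow> golden \<times> golden \<times> golden" where
  "half_form (m, n, c, s) = (m, n, c)"

lemma lin_half_form: "lin k z = affine_form (half_form k) z"
  by (cases k; cases z) simp

lemma center_interior: assumes "k \<in> set (stay_poly e)" shows "0 < lin k (center e)"
proof -
  have "list_all (\<lambda>k. gpos (eval5 (half_form k) (center5 True))) (stay_poly True)" by code_simp
  moreover have "list_all (\<lambda>k. gpos (eval5 (half_form k) (center5 False))) (stay_poly False)" by code_simp
  ultimately have "gpos (eval5 (half_form k) (center5 e))"
    using assms by (cases e) (auto simp only: list_all_iff)
  then show ?thesis using gpos_sound by (simp add: lin_half_form affine_form_center del: center5.simps)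
qed

lemma center_stay: "center e \<in> stay e"
proof -
  have "holds k (center e)" if "k \<in> set (stay_poly e)" for k
    using center_interior[OF that] by (simp add: holds_def)
  then have "center e \<in> region (stay_poly e)" by (simp add: region_def)
  then show ?thesis using stay_poly_stay by blast
qed

text \<open>
  On the pentagon $\hat T$ is a rotation of order five about the center, so the period under
  $\hat T$ is $1$ for the center and $5$ for every other point.
\<close>

lemma weighted_period_stay:
  assumes z: "z \<in> stay e"
  shows "weighted_period That (letter_weight a b) z
    = enat (if z = center e then (if e then a else b) else 5 * (if e then a else b))"
proof -
  let ?n = "if e then a else b"
  have sum: "(\<Sum>i<j. letter_weight a b ((That ^^ i) z)) = j * ?n" if "j \<le> 5" for j
  proof -
    have "(\<Sum>i<j. letter_weight a b ((That ^^ i) z)) = (\<Sum>i<j. ?n)"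
      using that branch_D0[OF stay_branch[OF z]] by (intro sum.cong) (simp_all add: letter_weight_def)
    then show ?thesis by simp
  qed
  have one: "(That ^^ 1) z = run (branch_word e) z" using stay_iterates[OF z, of 1] by simp
  show ?thesis
  proof (cases "z = center e")
    case True
    then have "(That ^^ 1) z = z" using one run_center by simp
    then show ?thesis using weighted_period_eq[of 1 That z "letter_weight a b"] sum[of 1] True by simp
  next
    case False
    then have ne: "(That ^^ 1) z \<noteq> z" using one run_fixed_center by metis
    have "weighted_period That (letter_weight a b) z = enat (\<Sum>i<5. letter_weight a b ((That ^^ i) z))"
    proof (rule weighted_period_divisors)
      show "(That ^^ 5) z = z" using stay_iterates[OF z, of 5] run_five by simp
      fix d :: nat assume d: "d dvd 5" "d < 5"
      then consider "d = 0" | "d = 1" | "d = 2" | "d = 3" | "d = 4" by linarith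
      then have "d = 1" using d(1) by cases simp_all
      with ne show "(That ^^ d) z \<noteq> z" by simp
    qed simp
    with sum[of 5] False show ?thesis by simp
  qed
qed

section \<open>Centroids\<close>

declare branch_word.simps [simp del]

lemma step_fst_snd: "step b z = (snd z, of_int b - fst z - \<tau> * snd z)"
  by (cases z) simp

lemma continuous_run: "continuous_on UNIV (run w)"
proof (induction w)
  case (Cons b w)
  have "continuous_on UNIV (step b)"
    unfolding step_fst_snd[abs_def] by (intro continuous_intros)
  then have "continuous_on UNIV (\<lambda>z. run w (step b z))"
    using continuous_on_compose2[OF Cons] by blast
  then show ?case by simp
qed (simp add: continuous_on_id)

lemma borel_run [measurable]: "run w \<in> borel_measurable borel"
  by (rule borel_measurable_continuous_onI[OF continuous_run])

lemma continuous_lin: "continuous_on UNIV (lin k)"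
proof -
  obtain m n c s where k: "k = (m, n, c, s)" by (metis surj_pair)
  have "lin k z = gval m * fst z + gval n * snd z + gval c" for z
    by (cases z) (simp add: k)
  then have "lin k = (\<lambda>z. gval m * fst z + gval n * snd z + gval c)" by blast
  then show ?thesis by (simp only:) (intro continuous_intros)
qed

lemma borel_lin [measurable]: "lin k \<in> borel_measurable borel"
  by (rule borel_measurable_continuous_onI[OF continuous_lin])

lemma borel_region: "region P \<in> sets borel"
proof -
  have "{z \<in> space borel. holds k z} \<in> sets borel" for k
    unfolding holds_def by measurable
  then have "(\<Inter>k\<in>set P. {z. holds k z}) \<inter> UNIV \<in> sets borel"
    by (cases "set P = {}") (auto intro!: sets.finite_INT)
  moreover have "region P = (\<Inter>k\<in>set P. {z. holds k z}) \<inter> UNIV" by (auto simp: region_def)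
  ultimately show ?thesis by simp
qed

text \<open>
  After exchanging the order of integration, the inner integral is only affected by a
  reflection and a translation of the line.
\<close>

lemma step_preserves_lborel:
  "distr lborel borel (step b) = (lborel :: (real \<times> real) measure)"
proof (rule measure_eqI)
  have st [measurable]: "step b \<in> borel_measurable borel"
    using borel_run[of "[b]"] by (simp add: run_def)
  fix A assume "A \<in> sets (distr lborel borel (step b))"
  then have A [measurable]: "A \<in> sets (borel :: (real \<times> real) measure)" by simp
  have A2 [measurable]: "A \<in> sets (borel \<Otimes>\<^sub>M borel)" using A unfolding borel_prod .
  let ?i = "indicator A :: real \<times> real \<Rightarrow> ennreal"
  have m: "(\<lambda>z. ?i (step b z)) \<in> borel_measurable (lborel \<Otimes>\<^sub>M lborel)"
    by (simp only: lborel_prod) measurable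
  have "emeasure (distr lborel borel (step b)) A = (\<integral>\<^sup>+z. ?i (step b z) \<partial>lborel)"
    using nn_integral_distr[of "step b" lborel borel ?i] by simp
  also have "\<dots> = (\<integral>\<^sup>+x. \<integral>\<^sup>+y. ?i (step b (x, y)) \<partial>lborel \<partial>lborel)"
    using lborel.nn_integral_fst[OF m] by (simp add: lborel_prod)
  also have "\<dots> = (\<integral>\<^sup>+y. \<integral>\<^sup>+x. ?i (y, of_int b - x - \<tau> * y) \<partial>lborel \<partial>lborel)"
    using lborel_pair.Fubini[OF m] by simp
  also have "\<dots> = (\<integral>\<^sup>+y. \<integral>\<^sup>+x. ?i (y, x) \<partial>lborel \<partial>lborel)"
  proof (rule nn_integral_cong)
    fix y :: real
    have "(\<integral>\<^sup>+x. ?i (y, x) \<partial>lborel) = ennreal \<bar>-1\<bar> * (\<integral>\<^sup>+x. ?i (y, (of_int b - \<tau> * y) + (-1) * x) \<partial>lborel)"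
      by (rule nn_integral_real_affine) simp_all
    then show "(\<integral>\<^sup>+x. ?i (y, of_int b - x - \<tau> * y) \<partial>lborel) = (\<integral>\<^sup>+x. ?i (y, x) \<partial>lborel)"
      by (simp add: algebra_simps)
  qed
  also have "\<dots> = (\<integral>\<^sup>+z. ?i z \<partial>(lborel \<Otimes>\<^sub>M lborel))"
    by (subst lborel.nn_integral_fst) simp_all
  also have "\<dots> = emeasure lborel A" by (simp add: lborel_prod)
  finally show "emeasure (distr lborel borel (step b)) A = emeasure lborel A" .
qed simp

lemma run_preserves_lborel:
  "distr lborel borel (run w) = (lborel :: (real \<times> real) measure)"
proof (induction w)
  case Nil
  have "distr lborel borel (\<lambda>z :: real \<times> real. z) = lborel"
    using distr_id2[of borel lborel] by simp
  then show ?case by (simp add: run_def)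
next
  case (Cons b w)
  have [measurable]: "step b \<in> borel_measurable borel"
    using borel_run[of "[b]"] by (simp add: run_def)
  have "run (b # w) = run w \<circ> step b" by (simp add: fun_eq_iff)
  then have "distr lborel borel (run (b # w)) = distr (distr lborel borel (step b)) borel (run w)"
    by (subst distr_distr) simp_all
  then show ?case by (simp only: step_preserves_lborel Cons)
qed

lemma run_stay_iff: "run (branch_word e) z \<in> stay e \<longleftrightarrow> z \<in> stay e"
proof -
  have "(\<forall>j<5. P ((f ^^ j) (f z))) \<longleftrightarrow> (\<forall>j<5. P ((f ^^ j) z))"
    if "(f ^^ 5) z = z" for f :: "real \<times> real \<Rightarrow> real \<times> real" and P
    using that by (auto simp: eval_nat_numeral All_less_Suc)
  from this[OF run_five] show ?thesis by (simp only: stay_characterization)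
qed

lemma bounded_stay: "bounded (stay e)"
proof -
  have "stay e \<subseteq> cbox (0, 0) (1, 1)"
    using Dset_square by (auto simp: stay_iff unit_square_def cbox_Pair_eq)
  then show ?thesis using bounded_cbox bounded_subset by blast
qed

lemma borel_stay: "stay e \<in> sets borel"
proof -
  have "stay e = (\<Inter>j\<in>{..<5}. run (concat (replicate j (branch_word e))) -` region (branch_poly e))"
    by (auto simp: stay_characterization branch_region run_funpow)
  also have "\<dots> \<in> sets borel"
  proof (intro sets.finite_INT)
    fix j show "run (concat (replicate j (branch_word e))) -` region (branch_poly e) \<in> sets borel"
      using measurable_sets_borel[OF borel_run borel_region] by simp
  qed (auto simp: lessThan_empty_iff)
  finally show ?thesis .
qed

lemma measure_stay_pos: "0 < measure lborel (stay e)"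
proof -
  have "open (\<Inter>k\<in>set (stay_poly e). {z. 0 < lin k z})"
    using open_Collect_less[OF continuous_on_const continuous_lin] by (intro open_INT) auto
  moreover have "center e \<in> (\<Inter>k\<in>set (stay_poly e). {z. 0 < lin k z})"
    using center_interior by blast
  ultimately obtain r where r: "0 < r" "ball (center e) r \<subseteq> (\<Inter>k\<in>set (stay_poly e). {z. 0 < lin k z})"
    by (meson open_contains_ball)
  have "(\<Inter>k\<in>set (stay_poly e). {z. 0 < lin k z}) \<subseteq> stay e"
    using stay_poly_stay[of e] by (force simp: region_def holds_def)
  with r have "ball (center e) r \<subseteq> stay e" by blast
  moreover have "stay e \<in> fmeasurable lborel"
    using borel_stay emeasure_bounded_finite[OF bounded_stay] by (intro fmeasurableI) simp_all
  ultimately have "measure lborel (ball (center e) r) \<le> measure lborel (stay e)"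
    by (intro measure_mono_fmeasurable) simp_all
  with content_ball_pos[OF r(1)] show ?thesis by (meson less_le_trans)
qed

text \<open>
  The rotation $F$ of order five preserves the pentagon and the measure, so $z$ may be replaced
  by $F^j(z)$ in the integral that defines the centroid. Averaging over $j < 5$ turns the integrand
  into the constant center.
\<close>

lemma centroid_stay: "centroid (stay e) = center e"
proof -
  let ?X = "stay e" and ?f = "\<lambda>j. run (concat (replicate j (branch_word e)))"
  define g where "g z = indicat_real ?X z *\<^sub>R z" for z
  have X [measurable]: "?X \<in> sets borel" by (rule borel_stay)
  have gm [measurable]: "g \<in> borel_measurable borel" unfolding g_def by measurable
  obtain B where B: "\<And>z. z \<in> ?X \<Longrightarrow> norm z \<le> B" using bounded_stay bounded_iff by metis
  have gi: "integrable lborel g"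
    by (rule integrableI_bounded_set[where A = ?X and B = B])
      (use emeasure_bounded_finite[OF bounded_stay] B in \<open>auto simp: g_def\<close>)
  have X_iff: "?f j z \<in> ?X \<longleftrightarrow> z \<in> ?X" for j z
    unfolding run_funpow by (induction j) (simp_all add: run_stay_iff del: branch_word.simps)
  have gj: "g (?f j z) = indicat_real ?X z *\<^sub>R ?f j z" for j z
    by (simp add: g_def X_iff indicator_def)
  have int_j: "integrable lborel (\<lambda>z. g (?f j z))" for j
    using integrable_distr_eq[of "?f j" lborel borel g] gi run_preserves_lborel by simp
  have eq_j: "(LINT z|lborel. g (?f j z)) = (LINT z|lborel. g z)" for j
    using integral_distr[of "?f j" lborel borel g] run_preserves_lborel by simp
  have "5 *\<^sub>R (LINT z|lborel. g z) = (\<Sum>j<5. LINT z|lborel. g (?f j z))"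
    by (simp add: eq_j sum_constant_scaleR)
  also have "\<dots> = (LINT z|lborel. (\<Sum>j<5. g (?f j z)))"
    using int_j by (intro Bochner_Integration.integral_sum[symmetric])
  also have "\<dots> = (LINT z|lborel. indicat_real ?X z *\<^sub>R (5 *\<^sub>R center e))"
    by (simp only: gj) (simp only: run_funpow scaleR_sum_right[symmetric] sum_five)
  also have "\<dots> = measure lborel ?X *\<^sub>R (5 *\<^sub>R center e)"
    using emeasure_bounded_finite[OF bounded_stay]
    by (subst integral_scaleR_left) (simp_all add: integrable_real_indicator)
  finally have "5 *\<^sub>R (LINT z|lborel. g z) = 5 *\<^sub>R (measure lborel ?X *\<^sub>R center e)"
    by (simp add: mult.commute)
  then have "(LINT z|lborel. g z) = measure lborel ?X *\<^sub>R center e"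
    by (simp only: scaleR_cancel_left) simp
  then show ?thesis
    using measure_stay_pos[of e] by (simp add: centroid_def set_lebesgue_integral_def g_def)
qed

section \<open>The complement of the tower over the smaller triangle\<close>

fun hat_orbit :: "halfplane list \<Rightarrow> bool list \<Rightarrow> halfplane list list" where
  "hat_orbit P [] = []"
| "hat_orbit P (e # v) = P # hat_orbit (flow e P) v"

definition D_pieces :: "halfplane list list" where
  "D_pieces = hat_orbit (map uimg D0_poly) [True, False, True]
     @ hat_orbit (map uimg D1_poly) [True, False, False, False, True] @ [alpha_poly, beta_poly]"

text \<open>
  Here and below the leaves refer to positions in the list of pieces; the cuts are made along
  edges of the pieces.
\<close>

definition D_tree :: bsp where
  "D_tree =
  (Cut ((1,0),(1,1),(0,-4),True) (Cut ((2,1),(1,1),(-1,-5),False) (Cut ((3,2),(0,0),(-1,-5),True)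
  (Piece 0) (Piece 3)) (Cut ((-1,-1),(0,0),(-1,4),False) (Cut ((-2,-1),(2,1),(1,-2),True)
  (Piece 1) (Piece 4)) (Piece 8))) (Cut ((0,0),(-2,-1),(0,4),True) (Cut ((2,1),(0,0),(-3,1),True)
  (Piece 2) (Piece 5)) (Cut ((-2,-1),(2,1),(1,-2),True) (Piece 6) (Cut ((2,1),(0,0),(-3,1),True)
  (Piece 7) (Piece 9)))))"

text \<open>
  The three levels over $U(D_0)$, the five levels over $U(D_1)$ and the two pentagons fill
  $\mathcal D$.
\<close>

lemma D_cover: "covers D_pieces D_tree D_poly" by code_simp

lemma hat_orbit_sound:
  assumes "hat_returns P v S" "Q \<in> set (hat_orbit P v)" "z \<in> region Q"
  shows "\<exists>u\<in>region P. \<exists>j. z = (That ^^ j) u"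
  using assms
proof (induction P v S rule: hat_returns.induct)
  case (2 P e v S)
  show ?case
  proof (cases "Q = P")
    case True
    then show ?thesis using 2(4) by (intro bexI[of _ z] exI[of _ 0]) simp_all
  next
    case False
    then obtain u j where u: "u \<in> region (flow e P)" "z = (That ^^ j) u" using 2 by auto
    obtain u' where u': "u' \<in> region P" "u = run (branch_word e) u'"
      using u(1) unfolding flow_def by (rule region_imgsE)
    have "inside P (branch_poly e)" using 2(2) by simp
    then have "u' \<in> branch_set e" using u'(1) inside_sound unfolding branch_region by blast
    then have "u = That u'" using That_branch(1) u'(2) by simp
    then have "z = (That ^^ Suc j) u'" using u(2) by (simp add: funpow_swap1)
    with u' show ?thesis by blast
  qed
qed simp

text \<open>
  A point in a level of the tower has a backward iterate in $U(\mathcal D)$, so a point whose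
  two-sided orbit avoids $U(\mathcal D)$ can only lie in one of the pentagons.
\<close>

lemma Pset_stay: assumes "w \<in> Pset" shows "w \<in> stay True \<union> stay False"
proof -
  have w: "w \<in> Dset" and avoid: "\<And>m. That_iter m w \<notin> Umap ` Dset" using assms by (auto simp: Pset_def)
  obtain Q where Q: "Q \<in> set D_pieces" "w \<in> region Q"
    using covers_sound[OF D_cover, of w] w by (auto simp: Dset_region)
  have no: False if mem: "Q \<in> set (hat_orbit (map uimg (branch_poly e)) (substitution e))" for e
  proof -
    obtain u j where u: "u \<in> region (map uimg (branch_poly e))" "w = (That ^^ j) u"
      using hat_orbit_sound[OF hat_return_U mem Q(2)] by blast
    have "u \<in> Umap ` branch_set e" using u(1) by (simp only: Umap_region branch_region)
    then have uU: "u \<in> Umap ` Dset" using branch_set_Dset by blast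
    moreover have "u \<in> Dset"
    proof -
      have "inside (map uimg (branch_poly e)) (branch_poly True)" using hat_return_U[of e] by (auto simp: substitution_def split: if_splits)
      then show ?thesis using u(1) inside_sound branch_region branch_set_Dset by blast
    qed
    ultimately show False
      using int_iter_uminus[OF bij_That, of u "int j"] u(2) avoid[of "- int j"] by simp
  qed
  have "Q \<in> set (hat_orbit (map uimg (branch_poly True)) (substitution True))
      \<or> Q \<in> set (hat_orbit (map uimg (branch_poly False)) (substitution False))
      \<or> Q = stay_poly True \<or> Q = stay_poly False"
    using Q(1) by (auto simp: D_pieces_def substitution_def stay_poly_def simp del: hat_orbit.simps)
  then show ?thesis using no Q(2) stay_poly_stay by blast
qed

section \<open>Iterating the renormalization S\<close>

text \<open>
  The weights of the two branches that give the period of a point $z$ in terms of the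
  $\hat T$-orbit of $S^n R(z)$.
\<close>

fun weight_a :: "nat \<Rightarrow> nat" and weight_b :: "nat \<Rightarrow> nat" where
  "weight_a 0 = 42"
| "weight_b 0 = 28"
| "weight_a (Suc n) = 2 * weight_a n + weight_b n"
| "weight_b (Suc n) = 2 * weight_a n + 3 * weight_b n"

lemma weight_closed:
  "3 * weight_a n = 2 * (35 * 4 ^ n + 28) \<and> 3 * weight_b n + 56 = 140 * 4 ^ n"
proof (induction n)
  case (Suc n)
  then show ?case by simp
qed simp

lemma weight_formulas:
  "2 * (35 * 4 ^ n + 28) div 3 = weight_a n" "10 * (35 * 4 ^ n + 28) div 3 = 5 * weight_a n"
  "4 * (35 * 4 ^ n - 14) div 3 = weight_b n" "20 * (35 * 4 ^ n - 14) div 3 = 5 * weight_b n"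
proof -
  have "2 * (35 * 4 ^ n + 28) = 3 * weight_a n" "10 * (35 * 4 ^ n + 28) = 3 * (5 * weight_a n)"
    "4 * (35 * 4 ^ n - 14) = 3 * weight_b n" "20 * (35 * 4 ^ n - 14) = 3 * (5 * weight_b n)"
    using weight_closed[of n] by (auto simp: diff_mult_distrib2)
  then show "2 * (35 * 4 ^ n + 28) div 3 = weight_a n" "10 * (35 * 4 ^ n + 28) div 3 = 5 * weight_a n"
    "4 * (35 * 4 ^ n - 14) div 3 = weight_b n" "20 * (35 * 4 ^ n - 14) div 3 = 5 * weight_b n"
    by simp_all
qed

text \<open>
  Growth of the weights excludes a finite period when $S^n R(z)$ is defined for all $n$.
\<close>

lemma weight_ge: "n \<le> weight_a n \<and> n < weight_b n"
  by (induction n) auto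

lemma Rmap_Dset:
  assumes z: "z \<in> unit_square" and m: "(Tmap ^^ m) z \<in> Dset"
  shows "Rmap z \<in> Dset" "min_period (Rmap z) = min_period z"
  using LeastI[of "\<lambda>m. (Tmap ^^ m) z \<in> Dset", OF m] min_period_funpow[OF z]
  by (simp_all add: Rmap_def)

text \<open>
  Both choices of the exponent lead to points of the same $\hat T$-orbit, and the weighted period
  is constant on orbits.
\<close>

lemma Smap_Dset:
  assumes s: "admissible_shat s" and w: "w \<in> Dset - Pset"
  shows "Smap s w \<in> Dset"
    "weighted_period That (letter_weight a b) w
      = weighted_period That (letter_weight (2 * a + b) (2 * a + 3 * b)) (Smap s w)"
proof -
  have "That_iter (s w) w \<in> Umap ` Dset" using s w by (auto simp: admissible_shat_def)
  then obtain v where v: "That_iter (s w) w = Umap v" "v \<in> Dset" by blast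
  have S: "Smap s w = v" using v(1) bij_is_inj[OF bij_Umap] by (simp add: Smap_def inv_f_f)
  then show "Smap s w \<in> Dset" using v by simp
  have "weighted_period That (letter_weight a b) w = weighted_period That (letter_weight a b) (Umap v)"
    using weighted_period_int_iter[OF bij_That, of w "letter_weight a b" "s w"] w v(1) by simp
  then show "weighted_period That (letter_weight a b) w
      = weighted_period That (letter_weight (2 * a + b) (2 * a + 3 * b)) (Smap s w)"
    unfolding S using weighted_period_Umap[OF v(2)] by simp
qed

lemma SR_period:
  assumes s: "admissible_shat s" and z: "z \<in> unit_square" and w: "SR s n z = Some w"
  shows "w \<in> Dset \<and> min_period z = weighted_period That (letter_weight (weight_a n) (weight_b n)) w"
  using w
proof (induction n arbitrary: w)
  case 0
  then have "z \<notin> Rset" and w: "w = Rmap z" by (auto split: if_splits)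
  then obtain m where "(Tmap ^^ m) z \<in> Dset" using z by (auto simp: Rset_def)
  from Rmap_Dset[OF z this] show ?case using min_period_Dset[of "Rmap z"] by (simp add: w)
next
  case (Suc n)
  then obtain v where v: "SR s n z = Some v" "v \<in> Dset - Pset" "w = Smap s v"
    by (auto split: option.splits if_splits)
  show ?case using Suc.IH[OF v(1)] Smap_Dset[OF s v(2)] by (simp add: v(3))
qed

lemma SR_stay_period:
  assumes s: "admissible_shat s" and z: "z \<in> unit_square" and w: "SR s n z = Some w" "w \<in> stay e"
  shows "min_period z = enat (if w = center e then (if e then weight_a n else weight_b n)
    else 5 * (if e then weight_a n else weight_b n))"
  using SR_period[OF s z w(1)] weighted_period_stay[OF w(2)] by simp

lemma SR_infinite:
  assumes s: "admissible_shat s" and z: "z \<in> unit_square"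
    and w: "\<forall>n. \<exists>w\<in>Dset - Pset. SR s n z = Some w"
  shows "min_period z = \<infinity>"
proof -
  have "enat n \<le> min_period z" for n
  proof -
    obtain w where "SR s n z = Some w" using w by blast
    from SR_period[OF s z this] have w: "w \<in> Dset"
      and p: "min_period z = weighted_period That (letter_weight (weight_a n) (weight_b n)) w" by auto
    show ?thesis unfolding p using weight_ge[of n]
      by (intro weighted_period_ge[OF That_Dset w]) (simp add: letter_weight_def)
  qed
  then have le: "enat n \<le> min_period z" for n .
  show ?thesis
  proof (cases "min_period z")
    case (enat m)
    with le[of "Suc m"] show ?thesis by simp
  qed
qed

section \<open>Points that never reach D\<close>

text \<open>
  This triangle is $T^{-28}(\mathcal D) = D_1 \cup T^{14}(D_0)$. Its levels together with the
  first $14$ levels over $\mathcal D$, where $D_0$ and $D_1$ still move together, make up the tower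
  over $\mathcal D$ with fewer pieces than the levels over $D_0$ and $D_1$ taken separately.
\<close>

definition D'_poly :: "halfplane list" where
  "D'_poly = [((0,0), (-1,0), (1,0), True), ((0,1), (1,0), (1,-4), True), ((-1,-1), (0,0), (-1,4), False)]"

lemma D'_follows: "follows D'_poly W1" by code_simp

lemma D'_end: "inside (imgs W1 D'_poly) D_poly" by code_simp

lemma D_follows: "follows D_poly (take 13 W1)" by code_simp

definition A_poly :: "halfplane list" where
  "A_poly = [((1,0),(0,0),(0,0),False), ((0,0),(1,0),(0,0),False), ((-1,0),(0,-1),(1,0),False),
    ((1,0),(-1,0),(0,1),False), ((0,1),(1,0),(1,-2),False), ((-1,-1),(0,0),(0,2),False),
    ((0,0),(-1,-1),(0,2),False), ((1,0),(0,1),(1,-2),False), ((-1,0),(1,0),(0,1),False),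
    ((0,-1),(-1,0),(1,0),False)]"

definition B_poly :: "halfplane list" where
  "B_poly = [((-1,0),(0,0),(1,0),True), ((0,0),(-1,0),(1,0),True), ((1,0),(0,1),(-1,0),True),
    ((-1,0),(1,0),(1,-1),True), ((0,-1),(-1,0),(-1,4),True), ((2,1),(0,0),(-2,1),True),
    ((0,0),(2,1),(-2,1),True), ((-1,0),(0,-1),(-1,4),True), ((1,0),(-1,0),(1,-1),True),
    ((0,1),(1,0),(-1,0),True)]"

definition Delta_poly :: "halfplane list" where
  "Delta_poly = [((-1,0),(0,0),(1,0),True), ((1,0),(0,1),(-1,0),True), ((0,-1),(-1,0),(-1,3),True),
    ((0,0),(2,1),(-1,1),True), ((1,0),(-1,0),(0,-1),True)]"

text \<open>
  The rhombus without its two opposite corners $(0,0)$ and $(\tau^4,\tau^4)$; cutting them off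
  with the strict inequalities $0 < x + y < 2\tau^4$ keeps the set convex.
\<close>

definition Gamma_poly :: "halfplane list" where
  "Gamma_poly = [((1,0),(0,0),(0,0),False), ((0,0),(1,0),(0,0),False), ((-1,0),(0,0),(2,-3),False),
    ((0,0),(-1,0),(2,-3),False), ((1,0),(1,0),(0,0),True), ((-1,0),(-1,0),(4,-6),True)]"

text \<open>
  The segments and points that are left between the polygons are described by half-planes as
  well.
\<close>

definition E_poly :: "halfplane list" where
  "E_poly = [((1,0),(-1,0),(0,0),False), ((-1,0),(1,0),(0,0),False), ((1,0),(0,0),(-4,5),True),
    ((-1,0),(0,0),(1,0),True)]"

fun point_poly :: "golden \<times> golden \<Rightarrow> halfplane list" where
  "point_poly (x, y) = [((1,0), (0,0), gsub (0,0) x, False), ((-1,0), (0,0), x, False),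
     ((0,0), (1,0), gsub (0,0) y, False), ((0,0), (-1,0), y, False)]"

definition W_Gamma :: "int list" where "W_Gamma = [1,1,2,1,1]"

definition W_E :: "int list" where
  "W_E = [2,2,1,1,1,1,1,1,1,2,2,2,2,2,2,2,1,1,1,1,1,1,1,2,2]"

definition W_11 :: "int list" where "W_11 = [2,2,1,1,1,1,1,1,1,2,2]"

lemma length_words [simp]: "length W_Gamma = 5" "length W_E = 25" "length W_11 = 11"
  by (simp_all add: W_Gamma_def W_E_def W_11_def)

lemma A_follows: "follows A_poly (replicate 10 1)" by code_simp

lemma B_follows: "follows B_poly (replicate 10 2)" by code_simp

lemma Delta_follows: "follows Delta_poly (concat (replicate 5 [2,1]))" by code_simp

lemma Gamma_follows: "follows Gamma_poly (W_Gamma @ W_Gamma)" by code_simp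

lemma E_follows: "follows E_poly (W_E @ W_E)" by code_simp

lemma p11_follows: "follows (point_poly ((4,-5),(4,-5))) W_11" by code_simp

text \<open>
  The successive images of a polygon along a word, without the last one.
\<close>

fun orbit :: "halfplane list \<Rightarrow> int list \<Rightarrow> halfplane list list" where
  "orbit P [] = []"
| "orbit P (b # w) = P # orbit (map (img b) P) w"

lemma orbit_mem:
  assumes "Q \<in> set (orbit P w)" "z \<in> region Q"
  shows "\<exists>u\<in>region P. \<exists>j<length w. z = run (take j w) u"
  using assms
proof (induction P w rule: orbit.induct)
  case (2 P b w)
  show ?case
  proof (cases "Q = P")
    case True
    with 2(3) show ?thesis by (intro bexI[of _ z] exI[of _ 0]) simp_all
  next
    case False
    with 2 obtain u j where u: "u \<in> region (map (img b) P)" "j < length w" "z = run (take j w) u" by auto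
    obtain v where v: "u = step b v" using surj_step by blast
    then have "v \<in> region P" using u(1) region_img by simp
    then show ?thesis using u v by (intro bexI[of _ v] exI[of _ "Suc j"]) simp_all
  qed
qed simp

lemma orbit_iterates:
  assumes "Q \<in> set (orbit P w)" "z \<in> region Q" "follows P (w @ v)"
  shows "\<exists>u\<in>region P. \<exists>j<length w. z = (Tmap ^^ j) u"
proof -
  obtain u j where u: "u \<in> region P" "j < length w" "z = run (take j w) u"
    using orbit_mem[OF assms(1,2)] by blast
  then have "z = (Tmap ^^ j) u" using follows_sound[OF assms(3) u(1), of j] by simp
  with u show ?thesis by blast
qed

definition square_poly :: "halfplane list" where
  "square_poly = [((1,0),(0,0),(0,0),False), ((0,0),(1,0),(0,0),False), ((-1,0),(0,0),(1,0),True),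
    ((0,0),(-1,0),(1,0),True)]"

lemma unit_square_region: "unit_square = region square_poly"
proof -
  have "(x, y) \<in> unit_square \<longleftrightarrow> (x, y) \<in> region square_poly" for x y :: real
    by (auto simp: unit_square_def region_def square_poly_def holds_def)
  then show ?thesis by auto
qed

text \<open>
  The order fixes the leaf numbers of the tree below: levels $0$ to $13$ over $\mathcal D$,
  then $28$ levels over the triangle above from $14$ on, the decagons $42$ and $43$, the pentagons
  from $44$, the rhombi from $46$, the segments from $51$, the points from $76$ and the origin
  $87$.
\<close>

definition square_pieces :: "halfplane list list" where
  "square_pieces = orbit D_poly (take 14 W1) @ orbit D'_poly W1 @ [A_poly, B_poly]
     @ orbit Delta_poly [2,1] @ orbit Gamma_poly W_Gamma @ orbit E_poly W_E
     @ orbit (point_poly ((4,-5),(4,-5))) W_11 @ [point_poly ((0,0),(0,0))]"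

definition square_tree :: bsp where
  "square_tree =
  (Cut ((0,1),(1,0),(-1,0),True) (Cut ((1,0),(-1,0),(1,-1),True) (Cut ((1,0),(0,1),(0,-2),True)
  (Cut ((-1,0),(1,0),(1,-1),True) (Cut ((1,0),(1,1),(-3,1),False) (Cut ((0,1),(0,-1),(0,0),True)
  (Piece 25) (Cut ((0,0),(2,1),(-3,1),True) (Cut ((0,1),(1,0),(1,-4),True)
  (Cut ((-1,-1),(0,0),(-1,4),False) (Piece 14) (Cut ((-1,0),(1,0),(0,0),True) (Piece 0)
  (Piece 51))) (Piece 65)) (Piece 76))) (Cut ((1,1),(1,0),(-3,1),True) (Piece 11)
  (Cut ((-1,0),(0,-1),(-1,4),True) (Piece 43) (Piece 62)))) (Cut ((1,0),(-1,0),(-1,1),True)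
  (Cut ((0,0),(-1,-1),(-1,3),False) (Piece 1) (Piece 15)) (Piece 66)))
  (Cut ((0,0),(2,1),(-2,1),True) (Cut ((0,0),(-1,-1),(0,2),True) (Cut ((1,0),(0,1),(-1,0),True)
  (Piece 43) (Cut ((-1,0),(0,-1),(1,0),True) (Cut ((-1,-1),(0,0),(-1,3),False) (Piece 2)
  (Piece 16)) (Piece 67))) (Cut ((2,1),(0,0),(-2,1),True) (Piece 43)
  (Cut ((-1,0),(1,0),(1,-2),True) (Cut ((0,0),(1,1),(0,-2),True) (Cut ((-1,0),(0,-1),(1,0),False)
  (Piece 27) (Cut ((-1,-1),(0,0),(-1,3),True) (Piece 13) (Piece 64))) (Piece 53)) (Piece 78))))
  (Cut ((-1,0),(-1,-1),(3,-2),True) (Cut ((-1,0),(0,-1),(0,2),True)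
  (Cut ((0,0),(-1,-1),(-1,3),True) (Cut ((-1,-1),(0,0),(-1,4),False) (Piece 12) (Piece 26))
  (Piece 63)) (Piece 52)) (Piece 77)))) (Cut ((-1,0),(1,0),(0,-1),True)
  (Cut ((1,1),(1,0),(-2,1),False) (Piece 32) (Cut ((-1,-1),(0,0),(-1,2),False) (Piece 34)
  (Piece 45))) (Cut ((0,-1),(-1,0),(0,2),True) (Cut ((-1,0),(0,-1),(-1,3),True) (Piece 36)
  (Cut ((1,0),(0,1),(-1,0),True) (Piece 41) (Piece 49))) (Cut ((0,0),(2,1),(-3,1),True)
  (Cut ((-1,0),(1,0),(-1,1),True) (Cut ((1,1),(1,0),(-3,2),False) (Piece 10)
  (Cut ((0,1),(1,0),(0,-2),True) (Piece 24) (Piece 75))) (Piece 61)) (Piece 86)))))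
  (Cut ((1,1),(0,0),(0,-2),True) (Cut ((-1,0),(1,0),(0,1),False) (Cut ((1,0),(0,1),(-1,0),True)
  (Cut ((-1,0),(1,0),(1,-1),True) (Piece 40) (Cut ((-1,0),(-1,-1),(2,-1),True) (Piece 31)
  (Piece 48))) (Cut ((-1,0),(0,0),(-1,3),True) (Cut ((-1,0),(0,-1),(1,0),True)
  (Cut ((0,0),(1,1),(-1,1),False) (Piece 6) (Cut ((-1,0),(1,0),(0,1),True) (Piece 20) (Piece 71)))
  (Piece 57)) (Piece 82))) (Cut ((1,0),(1,1),(-2,1),False) (Piece 35)
  (Cut ((-1,-1),(-1,0),(2,-1),True) (Piece 28) (Cut ((0,0),(-1,-1),(-1,2),False)
  (Cut ((1,0),(0,1),(-1,0),True) (Piece 33) (Piece 50)) (Cut ((-1,0),(0,-1),(1,0),False)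
  (Piece 37) (Piece 44)))))) (Cut ((-1,0),(0,-1),(-1,2),True) (Cut ((0,0),(1,1),(1,-2),True)
  (Cut ((0,-1),(-1,0),(-1,2),True) (Piece 29) (Cut ((1,1),(1,0),(1,-2),True)
  (Cut ((1,0),(1,1),(-1,1),True) (Cut ((1,0),(-1,0),(-1,2),False) (Piece 4)
  (Cut ((1,0),(0,0),(0,0),True) (Piece 18) (Piece 69))) (Piece 55)) (Piece 80)))
  (Cut ((1,0),(1,0),(0,0),True) (Cut ((2,1),(0,0),(-1,1),True) (Piece 38) (Piece 46)) (Piece 87)))
  (Cut ((0,0),(1,1),(0,-2),True) (Cut ((1,0),(-1,0),(0,1),True) (Cut ((-1,-1),(-1,0),(0,2),False)
  (Piece 5) (Cut ((0,-1),(-1,0),(1,0),True) (Piece 19) (Piece 70)))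
  (Cut ((0,-1),(-1,0),(-1,3),True) (Piece 39) (Cut ((-1,0),(0,0),(-1,2),True)
  (Cut ((1,1),(0,0),(1,-2),True) (Cut ((-1,0),(1,0),(0,-1),True) (Piece 30) (Piece 56))
  (Piece 47)) (Piece 81)))) (Cut ((-1,0),(1,0),(0,-1),True) (Cut ((1,1),(-1,-1),(0,2),True)
  (Cut ((0,0),(-1,-1),(0,2),True) (Cut ((1,0),(0,0),(0,0),True) (Cut ((-1,0),(-1,-1),(0,2),False)
  (Piece 8) (Piece 22)) (Piece 59)) (Piece 73)) (Piece 84)) (Cut ((1,0),(-1,0),(0,-1),True)
  (Cut ((-1,-1),(1,1),(0,2),True) (Cut ((0,0),(1,0),(0,0),True) (Cut ((-1,-1),(0,0),(0,2),True)
  (Cut ((1,0),(1,1),(-2,2),False) (Piece 3) (Piece 17)) (Piece 54)) (Piece 68)) (Piece 79))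
  (Cut ((1,0),(0,1),(-1,0),True) (Cut ((-1,-1),(-1,0),(3,-2),True) (Cut ((0,-1),(-1,0),(1,0),True)
  (Cut ((-1,0),(1,0),(-1,2),False) (Piece 9) (Cut ((-1,-1),(0,0),(0,2),True) (Piece 23)
  (Piece 74))) (Piece 60)) (Piece 85)) (Cut ((0,-1),(-1,0),(-1,2),True)
  (Cut ((1,0),(1,1),(1,-2),True) (Cut ((1,0),(0,1),(1,-2),True) (Cut ((0,0),(1,0),(0,0),True)
  (Cut ((1,1),(0,0),(-1,1),False) (Piece 7) (Piece 21)) (Piece 58)) (Piece 72)) (Piece 83))
  (Piece 42)))))))))"

lemma square_cover: "covers square_pieces square_tree square_poly" by code_simp

lemma point_region: "region (point_poly (x, y)) = {(gval x, gval y)}"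
proof -
  have "(u, v) \<in> region (point_poly (x, y)) \<longleftrightarrow> (u, v) = (gval x, gval y)" for u v :: real
    by (auto simp: region_def holds_def)
  then show ?thesis by auto
qed

lemma Titer_itinerary:
  assumes f: "follows P w" and z: "z \<in> region P" "z \<in> unit_square" and w: "w \<noteq> []" "run w z = z"
  shows "Titer (k + 1) z = mulA (Titer k z) + (0, of_int (w ! nat (k mod int (length w))))"
proof -
  define j where "j = nat (k mod int (length w))"
  have len: "0 < length w" using w(1) by simp
  have "(Tmap ^^ length w) z = z" using follows_sound[OF f z(1) order_refl] w(2) by simp
  then have k: "Titer k z = (Tmap ^^ j) z"
    using int_iter_periodic[OF bij_Tmap z(2) len] by (simp add: j_def)
  have j: "j < length w" using len by (simp add: j_def nat_less_iff)
  have "Tmap ((Tmap ^^ j) z) = step (w ! j) ((Tmap ^^ j) z)"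
    using follows_sound[OF f z(1), of j] follows_sound[OF f z(1), of "Suc j"] j
    by (simp add: take_Suc_conv_app_nth run_append)
  then show ?thesis
    using int_iter_succ[OF bij_Tmap z(2), of k] by (simp add: k step_mulA j_def)
qed

lemma A_poly_D_A: assumes "z \<in> region A_poly" "z \<in> unit_square" shows "z \<in> D_A"
proof -
  have "arun (replicate 10 1) ident = ident" by code_simp
  then have run: "run (replicate 10 1) z = z" by (simp only: run_affine affine_map_ident)
  have "nat (k mod 10) < 10" for k :: int by (simp add: nat_less_iff)
  then show ?thesis using Titer_itinerary[OF A_follows assms _ run] assms(2)
    by (simp add: D_A_def)
qed

lemma B_poly_D_B: assumes "z \<in> region B_poly" "z \<in> unit_square" shows "z \<in> D_B"
proof -
  have "arun (replicate 10 2) ident = ident" by code_simp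
  then have run: "run (replicate 10 2) z = z" by (simp only: run_affine affine_map_ident)
  have "nat (k mod 10) < 10" for k :: int by (simp add: nat_less_iff)
  then show ?thesis using Titer_itinerary[OF B_follows assms _ run] assms(2)
    by (simp add: D_B_def)
qed

lemma Delta_square: "region Delta_poly \<subseteq> unit_square"
  and Gamma_square: "region Gamma_poly \<subseteq> unit_square"
  and E_square: "region E_poly \<subseteq> unit_square"
  and point_square: "region (point_poly ((4,-5), (4,-5))) \<subseteq> unit_square"
proof -
  have "inside Delta_poly square_poly" "inside Gamma_poly square_poly" "inside E_poly square_poly"
    "inside (point_poly ((4,-5), (4,-5))) square_poly" by code_simp+
  then show "region Delta_poly \<subseteq> unit_square" "region Gamma_poly \<subseteq> unit_square"
    "region E_poly \<subseteq> unit_square" "region (point_poly ((4,-5), (4,-5))) \<subseteq> unit_square"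
    unfolding unit_square_region by (simp_all only: inside_sound)
qed

lemma Delta_poly_D_Delta: assumes "z \<in> region Delta_poly" shows "z \<in> D_Delta"
proof -
  let ?w = "concat (replicate 5 [2, 1]) :: int list"
  have z: "z \<in> unit_square" using assms Delta_square by blast
  have "arun ?w ident = ident" by code_simp
  then have run: "run ?w z = z" by (simp only: run_affine affine_map_ident)
  have len: "int (length ?w) = 10" by (simp add: eval_nat_numeral)
  have "?w \<noteq> []" by (simp add: eval_nat_numeral)
  note it = Titer_itinerary[OF Delta_follows assms z this run, unfolded len]
  have nth: "?w ! nat (k mod 10) = (if even k then 2 else 1)" for k :: int
  proof -
    have "k mod 10 \<in> {0, 1, 2, 3, 4, 5, 6, 7, 8, 9}"
      by (simp only: insert_iff empty_iff) presburger
    moreover have "even k \<longleftrightarrow> even (k mod 10)" by presburger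
    ultimately show ?thesis by (auto simp: eval_nat_numeral)
  qed
  show ?thesis
    using z it[of "2 * k" for k] it[of "2 * k - 1" for k] by (simp add: D_Delta_def nth)
qed

lemma Gamma_poly_D_Gamma: "region Gamma_poly = D_Gamma"
proof -
  have "(x, y) \<in> region Gamma_poly \<longleftrightarrow> (x, y) \<in> D_Gamma" for x y :: real
    unfolding D_Gamma_def tau_gamma by (auto simp: region_def Gamma_poly_def holds_def)
  then show ?thesis by auto
qed

lemma E_poly_D_E: "region E_poly = D_E"
proof -
  have "(x, y) \<in> region E_poly \<longleftrightarrow> (x, y) \<in> D_E" for x y :: real
    unfolding D_E_def tau_gamma by (auto simp: region_def E_poly_def holds_def)
  then show ?thesis by auto
qed

lemma take_orbit_D: "j < 14 \<Longrightarrow> take j (take 14 W1) = take j (take 13 W1)"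
  by (simp add: min_def)

lemma D_orbit_reaches:
  assumes "Q \<in> set (orbit D_poly (take 14 W1))" "z \<in> region Q"
  shows "\<exists>m. (Tmap ^^ m) z \<in> Dset"
proof -
  obtain u j where u: "u \<in> region D_poly" and j: "j < 14" and z: "z = run (take j (take 14 W1)) u"
    using orbit_mem[OF assms] by auto
  have zT: "z = (Tmap ^^ j) u"
    using follows_sound[OF D_follows u, of j] j by (simp only: z take_orbit_D) simp
  have uD: "u \<in> Dset" using u by (simp add: Dset_region)
  have "(Tmap ^^ (return_time u - j)) z = (Tmap ^^ (return_time u - j + j)) u"
    by (simp add: zT funpow_add)
  also have "\<dots> = That u" using return_time(2)[OF uD] j by (simp add: return_time_def)
  finally show ?thesis using return_time(3)[OF uD] by metis
qed

lemma D'_orbit_reaches: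
  assumes "Q \<in> set (orbit D'_poly W1)" "z \<in> region Q"
  shows "\<exists>m. (Tmap ^^ m) z \<in> Dset"
proof -
  obtain u j where u: "u \<in> region D'_poly" and j: "j < 28" and z: "z = run (take j W1) u"
    using orbit_mem[OF assms] by auto
  have zT: "z = (Tmap ^^ j) u" using follows_sound[OF D'_follows u, of j] j z by simp
  have "(Tmap ^^ (28 - j)) z = (Tmap ^^ (28 - j + j)) u" by (simp add: zT funpow_add)
  also have "\<dots> = run W1 u" using follows_sound[OF D'_follows u, of 28] j by simp
  also have "\<dots> \<in> Dset"
    using inside_sound[OF D'_end] u by (auto simp: Dset_region region_imgs)
  finally show ?thesis by metis
qed

definition pts :: "(real \<times> real) set" where
  "pts = pts1 \<union> pts2 \<union> pts5 \<union> pts10 \<union> pts11 \<union> pts25 \<union> pts50"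

text \<open>
  Every point of a level of the tower reaches $\mathcal D$ at the top of the tower, so a point
  that never does lies in one of the remaining pieces of the cover.
\<close>

lemma unreached_classification:
  assumes z: "z \<in> unit_square" and never: "\<And>m. (Tmap ^^ m) z \<notin> Dset"
  shows "z \<in> pts"
proof -
  obtain Q where Q: "Q \<in> set square_pieces" "z \<in> region Q"
    using covers_sound[OF square_cover, of z] z unit_square_region by auto
  consider "Q = A_poly" | "Q = B_poly" | "Q \<in> set (orbit Delta_poly [2, 1])"
    | "Q \<in> set (orbit Gamma_poly W_Gamma)" | "Q \<in> set (orbit E_poly W_E)"
    | "Q \<in> set (orbit (point_poly ((4,-5), (4,-5))) W_11)" | "Q = point_poly ((0,0), (0,0))"
    using Q(1) D_orbit_reaches[OF _ Q(2)] D'_orbit_reaches[OF _ Q(2)] never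
    unfolding square_pieces_def by (auto simp del: orbit.simps point_poly.simps)
  then show ?thesis
  proof cases
    case 1
    then show ?thesis using A_poly_D_A Q(2) z by (auto simp: pts_def pts10_def)
  next
    case 2
    then show ?thesis using B_poly_D_B Q(2) z by (auto simp: pts_def pts10_def)
  next
    case 3
    have "follows Delta_poly ([2, 1] @ concat (replicate 4 [2, 1]))"
      using Delta_follows by (simp add: eval_nat_numeral)
    from orbit_iterates[OF 3 Q(2) this]
    obtain u j where "u \<in> region Delta_poly" "j < length [2, 1 :: int]" "z = (Tmap ^^ j) u"
      by blast
    then have "u \<in> D_Delta" "j \<le> 1" "z = (Tmap ^^ j) u"
      using Delta_poly_D_Delta by simp_all
    then have "z \<in> (\<Union>m\<le>1. (Tmap ^^ m) ` D_Delta)" by (intro UN_I[of j] image_eqI[of _ _ u]) simp_all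
    then show ?thesis by (auto simp: pts_def pts10_def)
  next
    case 4
    from orbit_iterates[OF 4 Q(2) Gamma_follows]
    obtain u j where "u \<in> D_Gamma" "j < length W_Gamma" "z = (Tmap ^^ j) u"
      unfolding Gamma_poly_D_Gamma by blast
    then have "u \<in> D_Gamma" "j < 5" "z = (Tmap ^^ j) u"
      by (simp_all add: W_Gamma_def)
    then have "z \<in> (\<Union>m\<le>4. (Tmap ^^ m) ` D_Gamma)" by (intro UN_I[of j] image_eqI[of _ _ u]) simp_all
    then show ?thesis by (auto simp: pts_def pts10_def)
  next
    case 5
    from orbit_iterates[OF 5 Q(2) E_follows]
    obtain u j where "u \<in> D_E" "j < length W_E" "z = (Tmap ^^ j) u"
      unfolding E_poly_D_E by blast
    then have "u \<in> D_E" "j < 25" "z = (Tmap ^^ j) u"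
      by (simp_all add: W_E_def)
    then have "z \<in> (\<Union>m\<le>24. (Tmap ^^ m) ` D_E)" by (intro UN_I[of j] image_eqI[of _ _ u]) simp_all
    then show ?thesis by (auto simp: pts_def pts50_def)
  next
    case 6
    have "follows (point_poly ((4,-5), (4,-5))) (W_11 @ [])" using p11_follows by simp
    from orbit_iterates[OF 6 Q(2) this]
    obtain u j where "u \<in> region (point_poly ((4,-5), (4,-5)))" "j < length W_11" "z = (Tmap ^^ j) u"
      by blast
    then have "z = (Tmap ^^ j) (1 - 1 / \<gamma> ^ 5, 1 - 1 / \<gamma> ^ 5)" "j \<le> 10"
      by (simp_all add: W_11_def point_region tau_gamma del: point_poly.simps)
    then show ?thesis by (auto simp: pts_def pts11_def)
  next
    case 7
    then have "z = (0, 0)" using Q(2) by (simp add: point_region del: point_poly.simps)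
    then show ?thesis by (simp add: pts_def pts1_def)
  qed
qed

section \<open>The exceptional periods\<close>

text \<open>
  It suffices to exclude the maximal proper divisors of $p$ as periods.
\<close>

lemma min_period_maximal_divisors:
  assumes p: "1 \<le> p" "(Tmap ^^ p) z = z"
    and M: "\<And>d. d dvd p \<Longrightarrow> d < p \<Longrightarrow> \<exists>e\<in>M. d dvd e" "\<And>e. e \<in> M \<Longrightarrow> (Tmap ^^ e) z \<noteq> z"
  shows "min_period z = enat p"
proof -
  have "(Tmap ^^ d) z \<noteq> z" if d: "d dvd p" "d < p" for d
  proof
    assume fixed: "(Tmap ^^ d) z = z"
    obtain e where e: "e \<in> M" "d dvd e" using M(1)[OF d] by blast
    then obtain k where "e = d * k" by blast
    then have "(Tmap ^^ e) z = ((Tmap ^^ d) ^^ k) z" by (simp add: funpow_mult)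
    also have "\<dots> = z" using fixed by (induction k) simp_all
    finally show False using M(2)[OF e(1)] by simp
  qed
  from weighted_period_divisors[OF p this, of "\<lambda>_. 1"] show ?thesis
    by (simp add: min_period_weighted)
qed

lemma small_divisors: "d dvd m \<Longrightarrow> d < m \<Longrightarrow> d \<in> {1..<m}" for d m :: nat
  by (cases "d = 0") auto

lemma maximal_divisors:
  fixes d :: nat
  shows "d dvd 2 \<Longrightarrow> d < 2 \<Longrightarrow> \<exists>e\<in>{1}. d dvd e"
    "d dvd 5 \<Longrightarrow> d < 5 \<Longrightarrow> \<exists>e\<in>{1}. d dvd e"
    "d dvd 10 \<Longrightarrow> d < 10 \<Longrightarrow> \<exists>e\<in>{2, 5}. d dvd e"
    "d dvd 11 \<Longrightarrow> d < 11 \<Longrightarrow> \<exists>e\<in>{1}. d dvd e"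
    "d dvd 25 \<Longrightarrow> d < 25 \<Longrightarrow> \<exists>e\<in>{10}. d dvd e"
    "d dvd 50 \<Longrightarrow> d < 50 \<Longrightarrow> \<exists>e\<in>{10, 25}. d dvd e"
  using small_divisors[of d 2] apply (force simp: atLeastLessThan_nat_numeral)
  using small_divisors[of d 5] apply (force simp: atLeastLessThan_nat_numeral)
  using small_divisors[of d 10] apply (force simp: atLeastLessThan_nat_numeral)
  using small_divisors[of d 11] apply (force simp: atLeastLessThan_nat_numeral)
  using small_divisors[of d 25] apply (force simp: atLeastLessThan_nat_numeral)
  using small_divisors[of d 50] apply (force simp: atLeastLessThan_nat_numeral)
  done

lemma min_period_1: "Tmap z = z \<Longrightarrow> min_period z = 1"
  using min_period_maximal_divisors[of 1 z "{}"] by (simp add: one_enat_def)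

lemma run_bb_fixed:
  assumes "run [b, b] z = z" shows "z = (of_int b * (1 - \<tau>), of_int b * (1 - \<tau>))"
proof -
  obtain x y where z: "z = (x, y)" by (cases z)
  have 1: "of_int b - x - \<tau> * y = x" and 0: "of_int b - y - \<tau> * (of_int b - x - \<tau> * y) = y"
    using assms by (simp_all add: z)
  have 2: "of_int b - y - \<tau> * x = y" using 0 unfolding 1 .
  have "(2 - \<tau>) * (x - y) = 0" using 1 2 by (simp add: algebra_simps)
  then have xy: "y = x" using tau_bounds by simp
  have "(1 - \<tau>) * (x * (2 + \<tau>)) = (1 - \<tau>) * of_int b" using 1 unfolding xy by (simp add: algebra_simps)
  then have "x = of_int b * (1 - \<tau>)" by (simp add: algebra_simps tau_sq mult_tau_sq)
  then show ?thesis by (simp add: z xy)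
qed

lemma run_21_fixed:
  assumes "run [2, 1] z = z" shows "z = ((4 - \<tau>) / (3 + \<tau>), (2 - 2 * \<tau>) / (3 + \<tau>))"
proof -
  obtain x y where z: "z = (x, y)" by (cases z)
  have 1: "2 - x - \<tau> * y = x" and 0: "1 - y - \<tau> * (2 - x - \<tau> * y) = y"
    using assms by (simp_all add: z)
  have 2: "1 - y - \<tau> * x = y" using 0 unfolding 1 .
  have "2 * (2 - x - \<tau> * y) - \<tau> * (1 - y - \<tau> * x) = 2 * x - \<tau> * y" by (simp only: 1 2)
  then have x: "x * (3 + \<tau>) = 4 - \<tau>" by (simp add: algebra_simps mult_tau_sq tau_sq)
  have "2 * (1 - y - \<tau> * x) - \<tau> * (2 - x - \<tau> * y) = 2 * y - \<tau> * x" by (simp only: 1 2)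
  then have y: "y * (3 + \<tau>) = 2 - 2 * \<tau>" by (simp add: algebra_simps mult_tau_sq tau_sq)
  have "3 + \<tau> \<noteq> 0" using tau_bounds by simp
  with x y show ?thesis by (simp add: z eq_divide_eq)
qed

lemma pts1_tau: "pts1 = {(0, 0), (1 - \<tau>, 1 - \<tau>), (2 * (1 - \<tau>), 2 * (1 - \<tau>))}"
proof -
  have "2 / \<gamma>\<^sup>2 = 2 * (1 / \<gamma>\<^sup>2)" by simp
  then show ?thesis unfolding pts1_def by (simp only: tau_gamma)
qed

lemma pts2_tau:
  "pts2 = {((4 - \<tau>) / (3 + \<tau>), (2 - 2 * \<tau>) / (3 + \<tau>)), ((2 - 2 * \<tau>) / (3 + \<tau>), (4 - \<tau>) / (3 + \<tau>))}"
proof -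
  have "2 / \<gamma>\<^sup>2 = 2 - 2 * \<tau>" using tau_gamma(3) by (simp add: divide_inverse)
  moreover have "\<gamma>\<^sup>2 + 1 = 3 + \<tau>" by (simp add: gamma_tau power2_eq_square algebra_simps tau_sq)
  moreover have "5 - \<gamma> = 4 - \<tau>" by (simp add: gamma_tau)
  ultimately show ?thesis unfolding pts2_def by (simp only:)
qed

lemma period_pts1: assumes "z \<in> pts1" shows "min_period z = 1"
proof (rule min_period_1)
  consider "z = (0, 0)" | "z = (1 - \<tau>, 1 - \<tau>)" | "z = (2 * (1 - \<tau>), 2 * (1 - \<tau>))"
    using assms by (auto simp: pts1_tau)
  then show "Tmap z = z"
  proof cases
    case 1
    then show ?thesis by (simp add: Tmap_def)
  next
    case 2
    then have "step 1 z = z" by (simp add: algebra_simps tau_sq mult_tau_sq)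
    then show ?thesis using Tmap_step[of 1 z] 2 tau_bounds by simp
  next
    case 3
    then have "step 2 z = z" by (simp add: algebra_simps tau_sq mult_tau_sq)
    then show ?thesis using Tmap_step[of 2 z] 3 tau_bounds by simp
  qed
qed

lemma period_pts2: assumes "z \<in> pts2" shows "min_period z = 2"
proof -
  define x y where "x = (4 - \<tau>) / (3 + \<tau>)" and "y = (2 - 2 * \<tau>) / (3 + \<tau>)"
  have d: "0 < 3 + \<tau>" using tau_bounds by simp
  have b: "0 \<le> x" "x < 1" "0 \<le> y" "y < 1" "x \<noteq> y"
    using tau_bounds d by (simp_all add: x_def y_def field_simps)
  have s: "step 2 (x, y) = (y, x)" "step 1 (y, x) = (x, y)"
  proof -
    have xy: "x * (3 + \<tau>) = 4 - \<tau>" "y * (3 + \<tau>) = 2 - 2 * \<tau>"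
      using d by (simp_all add: x_def y_def)
    have "(2 - 2 * x - \<tau> * y) * (3 + \<tau>) = 2 * (3 + \<tau>) - 2 * (x * (3 + \<tau>)) - \<tau> * (y * (3 + \<tau>))"
      by (simp add: algebra_simps)
    also have "\<dots> = 0" unfolding xy by (simp add: algebra_simps tau_sq mult_tau_sq)
    finally have 1: "2 - 2 * x - \<tau> * y = 0" using d by simp
    have "(1 - 2 * y - \<tau> * x) * (3 + \<tau>) = (3 + \<tau>) - 2 * (y * (3 + \<tau>)) - \<tau> * (x * (3 + \<tau>))"
      by (simp add: algebra_simps)
    also have "\<dots> = 0" unfolding xy by (simp add: algebra_simps tau_sq mult_tau_sq)
    finally have "1 - 2 * y - \<tau> * x = 0" using d by simp
    with 1 show "step 2 (x, y) = (y, x)" "step 1 (y, x) = (x, y)" by simp_all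
  qed
  have T: "Tmap (x, y) = (y, x)" "Tmap (y, x) = (x, y)"
    using Tmap_step[of 2 "(x, y)"] Tmap_step[of 1 "(y, x)"] s b by simp_all
  have two: "min_period u = 2" if u: "u = (x, y) \<or> u = (y, x)" for u
  proof -
    have "min_period u = enat 2"
    proof (rule min_period_maximal_divisors[where M = "{1}"])
      show "(Tmap ^^ 2) u = u" using u T by (auto simp: eval_nat_numeral)
      show "\<And>e. e \<in> {1} \<Longrightarrow> (Tmap ^^ e) u \<noteq> u" using u T b by auto
    qed (use maximal_divisors(1) in auto)
    then show ?thesis by (simp add: numeral_eq_enat)
  qed
  show ?thesis using assms two unfolding pts2_tau x_def[symmetric] y_def[symmetric] by auto
qed

lemma min_period_10:
  assumes "(Tmap ^^ 10) z = z" "(Tmap ^^ 2) z \<noteq> z" "(Tmap ^^ 5) z \<noteq> z"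
  shows "min_period z = 10"
proof -
  have "min_period z = enat 10"
    by (rule min_period_maximal_divisors[where M = "{2, 5}"]) (use assms maximal_divisors(3) in auto)
  then show ?thesis by (simp add: numeral_eq_enat)
qed

lemma constant_itinerary:
  assumes "\<And>k :: int. Titer (k + 1) z = mulA (Titer k z) + (0, of_int b)"
  shows "(Tmap ^^ n) z = run (replicate n b) z"
proof (induction n)
  case (Suc n)
  have "(Tmap ^^ Suc n) z = step b ((Tmap ^^ n) z)"
    using assms[of "int n"] int_iter_of_nat[of unit_square Tmap "Suc n" z]
    by (simp add: step_mulA add.commute)
  also have "\<dots> = run (replicate n b @ [b]) z" by (simp add: Suc run_append)
  finally show ?case by (simp only: replicate_Suc replicate_append_same)
qed simp

lemma arun_constant:
  "arun (replicate 5 1) ident = (((-1,0), (0,0), (2,-2)), ((0,0), (-1,0), (2,-2)))"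
  "arun (replicate 5 2) ident = (((-1,0), (0,0), (4,-4)), ((0,0), (-1,0), (4,-4)))"
  "arun (replicate 10 1) ident = ident" "arun (replicate 10 2) ident = ident"
  by code_simp+

text \<open>
  The itinerary is constant, so $T$ acts on the decagon as a fixed affine map with linear part
  $A$. Its tenth power is the identity, its fifth power is the point reflection at the center, and
  its square fixes only the center.
\<close>

lemma period_D_A: assumes "z \<in> D_A" "z \<notin> pts1" shows "min_period z = 10"
proof -
  have T: "(Tmap ^^ n) z = run (replicate n 1) z" for n
    using assms(1) by (intro constant_itinerary) (simp add: D_A_def)
  have ne: "z \<noteq> (1 - \<tau>, 1 - \<tau>)" using assms(2) by (auto simp: pts1_tau)
  obtain x y where z: "z = (x, y)" by (cases z)
  show ?thesis
  proof (rule min_period_10)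
    show "(Tmap ^^ 10) z = z" by (simp only: T run_affine arun_constant affine_map_ident)
    show "(Tmap ^^ 2) z \<noteq> z"
      using run_bb_fixed[of 1 z] ne T[of 2] by (auto simp: numeral_2_eq_2 simp del: funpow.simps)
    show "(Tmap ^^ 5) z \<noteq> z"
      using run_reflection[OF arun_constant(1), of x y] ne T[of 5] unfolding z by auto
  qed
qed

lemma period_D_B: assumes "z \<in> D_B" "z \<notin> pts1" shows "min_period z = 10"
proof -
  have T: "(Tmap ^^ n) z = run (replicate n 2) z" for n
    using assms(1) by (intro constant_itinerary) (simp add: D_B_def)
  have ne: "z \<noteq> (2 * (1 - \<tau>), 2 * (1 - \<tau>))" using assms(2) by (auto simp: pts1_tau)
  obtain x y where z: "z = (x, y)" by (cases z)
  show ?thesis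
  proof (rule min_period_10)
    show "(Tmap ^^ 10) z = z" by (simp only: T run_affine arun_constant affine_map_ident)
    show "(Tmap ^^ 2) z \<noteq> z"
      using run_bb_fixed[of 2 z] ne T[of 2] by (auto simp: numeral_2_eq_2 simp del: funpow.simps)
    show "(Tmap ^^ 5) z \<noteq> z"
      using run_reflection[OF arun_constant(2), of x y] ne T[of 5] unfolding z by auto
  qed
qed

text \<open>
  The letters alternate, so a point and its fifth iterate have different itineraries, and $T^2$
  fixes only the center of the pentagon.
\<close>

lemma period_D_Delta:
  assumes "u \<in> D_Delta" "m \<le> 1" "(Tmap ^^ m) u \<notin> pts2"
  shows "min_period ((Tmap ^^ m) u) = 10"
proof -
  have u: "u \<in> unit_square" using assms(1) by (simp add: D_Delta_def)
  have even: "(Tmap ^^ Suc (2 * n)) u = step 2 ((Tmap ^^ (2 * n)) u)" for n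
  proof -
    have "Titer (2 * int n + 1) u = mulA (Titer (2 * int n) u) + (0, 2)"
      using assms(1) by (simp add: D_Delta_def)
    then show ?thesis
      using int_iter_of_nat[of unit_square Tmap "Suc (2 * n)" u] int_iter_of_nat[of unit_square Tmap "2 * n" u]
      by (simp add: step_mulA add.commute)
  qed
  have odd: "(Tmap ^^ Suc (Suc (2 * n))) u = step 1 ((Tmap ^^ Suc (2 * n)) u)" for n
  proof -
    have "Titer (2 * int (Suc n)) u = mulA (Titer (2 * int (Suc n) - 1) u) + (0, 1)"
      using assms(1) unfolding D_Delta_def by blast
    then show ?thesis
      using int_iter_of_nat[of unit_square Tmap "Suc (2 * n)" u]
        int_iter_of_nat[of unit_square Tmap "Suc (Suc (2 * n))" u]
      by (simp add: step_mulA add.commute)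
  qed
  have T: "(Tmap ^^ (2 * n)) u = run (concat (replicate n [2, 1])) u" for n
  proof (induction n)
    case (Suc n)
    have "(Tmap ^^ (2 * Suc n)) u = run [2, 1] ((Tmap ^^ (2 * n)) u)"
      using even[of n] odd[of n] by (simp del: funpow.simps)
    also have "\<dots> = run (concat (replicate n [2, 1] @ [[2, 1]])) u" by (simp add: Suc run_append)
    finally show ?case by (simp only: replicate_Suc replicate_append_same)
  qed simp
  have "min_period u = 10"
  proof (rule min_period_10)
    have "arun (concat (replicate 5 [2, 1])) ident = ident" by code_simp
    then have "run (concat (replicate 5 [2, 1])) u = u" by (simp only: run_affine affine_map_ident)
    then show "(Tmap ^^ 10) u = u" using T[of 5] by simp
    show "(Tmap ^^ 2) u \<noteq> u"
    proof
      assume "(Tmap ^^ 2) u = u"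
      then have "run [2, 1] u = u" using T[of 1] by simp
      then have p: "u \<in> pts2" and ue: "u = ((4 - \<tau>) / (3 + \<tau>), (2 - 2 * \<tau>) / (3 + \<tau>))"
        using run_21_fixed by (auto simp: pts2_tau)
      have "step 2 u = ((2 - 2 * \<tau>) / (3 + \<tau>), (4 - \<tau>) / (3 + \<tau>))"
        using tau_bounds by (simp add: ue field_simps tau_sq mult_tau_sq)
      then have "Tmap u \<in> pts2" using even[of 0] by (simp add: pts2_tau)
      with p have "(Tmap ^^ m) u \<in> pts2" using assms(2) by (cases m) auto
      with assms(3) show False by simp
    qed
    show "(Tmap ^^ 5) u \<noteq> u"
    proof
      assume 5: "(Tmap ^^ 5) u = u"
      have "step 2 u = Tmap u" using even[of 0] by simp
      also have "\<dots> = step 1 u" using odd[of 2] 5 by (simp add: eval_nat_numeral)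
      finally show False by (cases u) simp
    qed
  qed
  then show ?thesis using min_period_funpow[OF u] by simp
qed

text \<open>
  On the rhombus $T^5$ is the point reflection at its center.
\<close>

lemma arun_Gamma: "arun W_Gamma ident = (((-1,0), (0,0), (2,-3)), ((0,0), (-1,0), (2,-3)))"
  by code_simp

lemma Gamma_iterates:
  assumes "u \<in> D_Gamma" "j \<le> 10"
  shows "(Tmap ^^ j) u = run (take j (W_Gamma @ W_Gamma)) u"
  using follows_sound[OF Gamma_follows, of u j] assms by (simp add: Gamma_poly_D_Gamma)

lemma Gamma_5: "(x, y) \<in> D_Gamma \<Longrightarrow> (Tmap ^^ 5) (x, y) = (2 - 3 * \<tau> - x, 2 - 3 * \<tau> - y)"
  using Gamma_iterates[of "(x, y)" 5] run_reflection[OF arun_Gamma, of x y] by simp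

lemma Gamma_10: assumes "u \<in> D_Gamma" shows "(Tmap ^^ 10) u = u"
proof -
  have "arun (W_Gamma @ W_Gamma) ident = ident" by code_simp
  then have "run (W_Gamma @ W_Gamma) u = u" by (simp only: run_affine affine_map_ident)
  then show ?thesis using Gamma_iterates[OF assms, of 10] by simp
qed

lemma Gamma_center: "1 / (2 * \<gamma> ^ 4) = (2 - 3 * \<tau>) / 2"
proof -
  have "1 / (2 * \<gamma> ^ 4) = (1 / \<gamma> ^ 4) / 2" by simp
  then show ?thesis by (simp only: tau_gamma)
qed

lemma D_Gamma_square: "D_Gamma \<subseteq> unit_square"
  using Gamma_square by (simp add: Gamma_poly_D_Gamma)

lemma period_pts5: assumes "z \<in> pts5" shows "min_period z = 5"
proof -
  let ?h = "(2 - 3 * \<tau>) / 2"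
  let ?u = "(?h, ?h)"
  obtain m where z: "z = (Tmap ^^ m) ?u" using assms by (auto simp: pts5_def Gamma_center)
  have u: "?u \<in> D_Gamma" unfolding D_Gamma_def tau_gamma using tau_bounds by auto
  have "min_period ?u = enat 5"
  proof (rule min_period_maximal_divisors[where M = "{1}"])
    show "(Tmap ^^ 5) ?u = ?u" using Gamma_5[OF u] by (simp add: field_simps)
    have "Tmap ?u = step 1 ?u" using Gamma_iterates[OF u, of 1] by (simp add: W_Gamma_def)
    moreover have "step 1 ?u \<noteq> ?u"
      using tau_bounds by (simp add: field_simps tau_sq mult_tau_sq)
    ultimately show "\<And>e. e \<in> {1} \<Longrightarrow> (Tmap ^^ e) ?u \<noteq> ?u" by simp
  qed (use maximal_divisors(2) in auto)
  then show ?thesis using min_period_funpow[of ?u m] u D_Gamma_square z by (auto simp: numeral_eq_enat)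
qed

lemma period_D_Gamma:
  assumes u: "u \<in> D_Gamma" and m: "m \<le> 4" "(Tmap ^^ m) u \<notin> pts5"
  shows "min_period ((Tmap ^^ m) u) = 10"
proof -
  obtain x y where xy: "u = (x, y)" by (cases u)
  have "min_period u = 10"
  proof (rule min_period_10)
    show "(Tmap ^^ 10) u = u" using Gamma_10[OF u] .
    show "(Tmap ^^ 2) u \<noteq> u"
    proof
      assume "(Tmap ^^ 2) u = u"
      then have "run [1, 1] u = u" using Gamma_iterates[OF u, of 2] by (simp add: W_Gamma_def)
      then have "x = 1 - \<tau>" using run_bb_fixed[of 1 u] by (simp add: xy)
      moreover have "x \<le> 2 - 3 * \<tau>" using u unfolding D_Gamma_def tau_gamma xy by simp
      ultimately show False using tau_bounds by simp
    qed
    show "(Tmap ^^ 5) u \<noteq> u"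
    proof
      assume "(Tmap ^^ 5) u = u"
      then have "u = ((2 - 3 * \<tau>) / 2, (2 - 3 * \<tau>) / 2)" using Gamma_5[of x y] u by (simp add: xy)
      then have "(Tmap ^^ m) u \<in> pts5" using m(1) by (auto simp: pts5_def Gamma_center)
      with m(2) show False by simp
    qed
  qed
  then show ?thesis using min_period_funpow[of u m] u D_Gamma_square by auto
qed

lemma period_pts10: assumes "z \<in> pts10" shows "min_period z = 10"
proof -
  have no: "z \<notin> pts1" "z \<notin> pts2" "z \<notin> pts5" using assms by (auto simp: pts10_def)
  consider "z \<in> D_A" | "z \<in> D_B" | m u where "m \<le> 4" "u \<in> D_Gamma" "z = (Tmap ^^ m) u"
    | m u where "m \<le> 1" "u \<in> D_Delta" "z = (Tmap ^^ m) u"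
    using assms unfolding pts10_def by blast
  then show ?thesis
  proof cases
    case 1 then show ?thesis using period_D_A no by blast
  next
    case 2 then show ?thesis using period_D_B no by blast
  next
    case 3 then show ?thesis using period_D_Gamma no by blast
  next
    case 4 then show ?thesis using period_D_Delta no by blast
  qed
qed

lemma period_pts11: assumes "z \<in> pts11" shows "min_period z = 11"
proof -
  let ?u = "(4 - 5 * \<tau>, 4 - 5 * \<tau>)"
  obtain m where z: "z = (Tmap ^^ m) ?u" using assms by (auto simp: pts11_def tau_gamma)
  have u: "?u \<in> region (point_poly ((4,-5), (4,-5)))" by (simp add: point_region del: point_poly.simps)
  have T: "(Tmap ^^ j) ?u = run (take j W_11) ?u" if "j \<le> 11" for j
    using follows_sound[OF p11_follows u, of j] that by simp
  let ?c = "(((0,0), (0,0), (4,-5)), ((0,0), (0,0), (4,-5)))"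
  have "arun W_11 ?c = ?c" by code_simp
  moreover have "affine_map ?c ?u = ?u" by (simp add: affine_map_def)
  ultimately have W: "run W_11 ?u = ?u" using affine_map_arun[of W_11 ?c ?u] by simp
  have "min_period ?u = enat 11"
  proof (rule min_period_maximal_divisors[where M = "{1}"])
    show "(Tmap ^^ 11) ?u = ?u" using T[of 11] W by simp
    have "Tmap ?u = step 2 ?u" using T[of 1] by (simp add: W_11_def)
    moreover have "step 2 ?u \<noteq> ?u"
      using tau_bounds by (simp add: algebra_simps tau_sq mult_tau_sq)
    ultimately show "\<And>e. e \<in> {1} \<Longrightarrow> (Tmap ^^ e) ?u \<noteq> ?u" by simp
  qed (use maximal_divisors(4) in auto)
  then show ?thesis using min_period_funpow[of ?u m] u point_square z by (auto simp: numeral_eq_enat)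
qed

lemma E_iterates:
  assumes "u \<in> D_E" "j \<le> 50"
  shows "(Tmap ^^ j) u = run (take j (W_E @ W_E)) u"
  using follows_sound[OF E_follows, of u j] assms by (simp add: E_poly_D_E)

text \<open>
  On the segment $T^{25}$ is the reflection at its midpoint, because $A^{25} = -1$.
\<close>

lemma E_25: assumes "(x, y) \<in> D_E" shows "(Tmap ^^ 25) (x, y) = (5 - 5 * \<tau> - x, 5 - 5 * \<tau> - y)"
proof -
  have "arun W_E ident = (((-1,0), (0,0), (5,-5)), ((0,0), (-1,0), (5,-5)))" by code_simp
  from run_reflection[OF this, of x y] show ?thesis
    using E_iterates[OF assms, of 25] by simp
qed

lemma E_50: assumes "(x, y) \<in> D_E" shows "(Tmap ^^ 50) (x, y) = (x, y)"
proof -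
  have "arun (W_E @ W_E) ident = ident" by code_simp
  then have "run (W_E @ W_E) (x, y) = (x, y)" by (simp only: run_affine affine_map_ident)
  then show ?thesis using E_iterates[OF assms, of 50] by simp
qed

text \<open>
  Since $A^{10} = 1$, the tenth iterate is a translation; it is nonzero. This excludes all
  periods that divide $10$.
\<close>

lemma E_10: assumes "u \<in> D_E" shows "(Tmap ^^ 10) u \<noteq> u"
proof -
  have "arun (take 10 W_E) ident = (((1,0), (0,0), (-1,1)), ((0,0), (1,0), (0,0)))" by code_simp
  then have "run (take 10 W_E) u \<noteq> u"
    using tau_bounds by (cases u) (simp add: run_affine affine_map_def)
  then show ?thesis using E_iterates[OF assms, of 10] by simp
qed

lemma E_center: "1 - 1 / (2 * \<gamma> ^ 5) = (5 - 5 * \<tau>) / 2"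
proof -
  have "1 / (2 * \<gamma> ^ 5) = (1 / \<gamma> ^ 5) / 2" by simp
  then show ?thesis by (simp only: tau_gamma) (simp add: field_simps)
qed

lemma D_E_square: "D_E \<subseteq> unit_square"
  using E_square by (simp add: E_poly_D_E)

lemma period_pts25: assumes "z \<in> pts25" shows "min_period z = 25"
proof -
  let ?u = "((5 - 5 * \<tau>) / 2, (5 - 5 * \<tau>) / 2)"
  obtain m where z: "z = (Tmap ^^ m) ?u" using assms by (auto simp: pts25_def E_center)
  have u: "?u \<in> D_E"
    unfolding D_E_def tau_gamma
    by (rule CollectI, rule exI[of _ "(5 - 5 * \<tau>) / 2"]) (use tau_bounds in auto)
  have "min_period ?u = enat 25"
  proof (rule min_period_maximal_divisors[where M = "{10}"])
    show "(Tmap ^^ 25) ?u = ?u" using E_25[OF u] by (simp add: field_simps)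
  qed (use maximal_divisors(5) E_10[OF u] in auto)
  then show ?thesis using min_period_funpow[of ?u m] u D_E_square z by (auto simp: numeral_eq_enat)
qed

lemma period_pts50: assumes "z \<in> pts50" shows "min_period z = 50"
proof -
  obtain m u where m: "m \<le> 24" "u \<in> D_E" "z = (Tmap ^^ m) u"
    using assms unfolding pts50_def by blast
  obtain x y where xy: "u = (x, y)" by (cases u)
  have 25: "(Tmap ^^ 25) u \<noteq> u"
  proof
    assume "(Tmap ^^ 25) u = u"
    then have "u = ((5 - 5 * \<tau>) / 2, (5 - 5 * \<tau>) / 2)" using E_25[of x y] m(2) by (simp add: xy)
    then have "z \<in> pts25" using m by (auto simp: pts25_def E_center)
    then show False using assms by (simp add: pts50_def)
  qed
  have "min_period u = enat 50"
    by (rule min_period_maximal_divisors[where M = "{10, 25}"])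
      (use maximal_divisors(6) E_10[OF m(2)] E_50[of x y] 25 m(2) xy in auto)
  then show ?thesis using min_period_funpow[of u m] m D_E_square by (auto simp: numeral_eq_enat)
qed

section \<open>The classification of the periods\<close>

theorem theorem8p1:
  fixes z :: "real \<times> real" and s :: "real \<times> real \<Rightarrow> int"
  assumes "z \<in> unit_square"
    and "admissible_shat s"
  shows
    "(z \<in> pts1 \<longrightarrow> min_period z = 1) \<and>
     (z \<in> pts2 \<longrightarrow> min_period z = 2) \<and>
     (z \<in> pts5 \<longrightarrow> min_period z = 5) \<and>
     (z \<in> pts10 \<longrightarrow> min_period z = 10) \<and>
     (z \<in> pts11 \<longrightarrow> min_period z = 11) \<and>
     (z \<in> pts25 \<longrightarrow> min_period z = 25) \<and>
     (z \<in> pts50 \<longrightarrow> min_period z = 50) \<and>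
     (\<forall>n. SR s n z = Some (centroid D_alpha) \<longrightarrow>
        min_period z = enat (2 * (35 * 4 ^ n + 28) div 3)) \<and>
     (\<forall>n. \<forall>w \<in> D_alpha - {centroid D_alpha}. SR s n z = Some w \<longrightarrow>
        min_period z = enat (10 * (35 * 4 ^ n + 28) div 3)) \<and>
     (\<forall>n. SR s n z = Some (centroid D_beta) \<longrightarrow>
        min_period z = enat (4 * (35 * 4 ^ n - 14) div 3)) \<and>
     (\<forall>n. \<forall>w \<in> D_beta - {centroid D_beta}. SR s n z = Some w \<longrightarrow>
        min_period z = enat (20 * (35 * 4 ^ n - 14) div 3)) \<and>
     ((\<forall>n. \<exists>w \<in> Dset - Pset. SR s n z = Some w) \<longrightarrow> min_period z = \<infinity>) \<and>
     (z \<in> pts1 \<union> pts2 \<union> pts5 \<union> pts10 \<union> pts11 \<union> pts25 \<union> pts50 \<or>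
      (\<exists>n. \<exists>w \<in> D_alpha \<union> D_beta. SR s n z = Some w) \<or>
      (\<forall>n. \<exists>w \<in> Dset - Pset. SR s n z = Some w))"
proof -
  have stays: "D_alpha = stay True" "D_beta = stay False" by (simp_all add: stay_def)
  have period: "min_period z = enat (if w = center e then (if e then weight_a n else weight_b n)
      else 5 * (if e then weight_a n else weight_b n))"
    if "SR s n z = Some w" "w \<in> stay e" for n w e
    using SR_stay_period[OF assms(2,1) that] .
  have classify: "\<forall>n. \<exists>w \<in> Dset - Pset. SR s n z = Some w"
    if no: "z \<notin> pts" "\<not> (\<exists>n. \<exists>w \<in> D_alpha \<union> D_beta. SR s n z = Some w)"
  proof
    fix n
    have free: "\<exists>w \<in> Dset - Pset. SR s n z = Some w" if "SR s n z = Some w" for n w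
      using SR_period[OF assms(2,1) that] Pset_stay[of w] no(2) that unfolding stays by blast
    show "\<exists>w \<in> Dset - Pset. SR s n z = Some w"
    proof (induction n)
      case 0
      have "z \<notin> Rset" using unreached_classification[OF assms(1)] no(1) by (auto simp: Rset_def)
      then show ?case using free[of 0 "Rmap z"] by simp
    next
      case (Suc n)
      then obtain w where "w \<in> Dset - Pset" "SR s n z = Some w" by blast
      then show ?case using free[of "Suc n" "Smap s w"] by simp
    qed
  qed
  have centers: "centroid (stay True) = center True" "centroid (stay False) = center False"
    by (simp_all add: centroid_stay)
  show ?thesis
    unfolding stays centers weight_formulas
  proof (intro conjI allI ballI impI)
    show "min_period z = enat (weight_a n)" if "SR s n z = Some (center True)" for n
      using period[OF that center_stay] by simp
    show "min_period z = enat (weight_b n)" if "SR s n z = Some (center False)" for n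
      using period[OF that center_stay] by simp
    show "min_period z = enat (5 * weight_a n)"
      if "w \<in> stay True - {center True}" "SR s n z = Some w" for n w
      using period[OF that(2), of True] that(1) by simp
    show "min_period z = enat (5 * weight_b n)"
      if "w \<in> stay False - {center False}" "SR s n z = Some w" for n w
      using period[OF that(2), of False] that(1) by simp
    show "min_period z = \<infinity>" if "\<forall>n. \<exists>w \<in> Dset - Pset. SR s n z = Some w"
      using SR_infinite[OF assms(2,1) that] .
    show "z \<in> pts1 \<union> pts2 \<union> pts5 \<union> pts10 \<union> pts11 \<union> pts25 \<union> pts50 \<or>
      (\<exists>n. \<exists>w \<in> stay True \<union> stay False. SR s n z = Some w) \<or>
      (\<forall>n. \<exists>w \<in> Dset - Pset. SR s n z = Some w)"
      using classify unfolding pts_def stays by blast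
  qed (fact period_pts1 period_pts2 period_pts5 period_pts10 period_pts11 period_pts25 period_pts50)+
qed

end
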